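(* Let $A\in\mathbb{Z}^{m\times s}$ be saturated with columns $F_1,\dots,F_s$, and let $I_{\mathcal{P}_A}$ be the toric ideal of $\mathcal{P}_A$ in the polynomial ring $\mathbb{K}[z,x_{F_1^+},x_{F_1^-},\dots,x_{F_s^+},x_{F_s^-}]$ equipped with the degree reverse lexicographic order induced by $z\prec x_{F_1^+}\prec x_{F_1^-}\prec\cdots\prec x_{F_s^+}\prec x_{F_s^-}$. Then the following binomials form a Gröbner basis of $I_{\mathcal{P}_A}$, and in each binomial as written the first monomial (with positive sign) is the initial term: (1) For every minimal linear dependency $\mathbf{a}$ with $|M_{\mathbf{a}}|=2k$ and every $k$-element submultiset $M\subseteq M_{\mathbf{a}}$ such that (a) $+F_{\min(\mathbf{a})}\notin M$ if $\mathbf{a}_{\min(\mathbf{a})}>0$, and (b) the multiset consisting of $-F_{\min(\mathbf{a})}$ with multiplicity $|\mathbf{a}_{\min(\mathbf{a})}|$ is not contained in $M$ if $\mathbf{a}_{\min(\mathbf{a})}<0$: the binomial $\prod_{F\in M}x_F-\prod_{F\in M_{\mathbf{a}}\setminus M}x_{\overline F}$. (2) For every minimal linear dependency $\mathbf{a}$ with $|M_{\mathbf{a}}|=2k+1$ and every $(k+1)$-element submultiset $M\subseteq M_{\mathbf{a}}$: $\prod_{F\in M}x_F-z\prod_{F\in M_{\mathbf{a}}\setminus M}x_{\overline F}$. (3) For every minimal linear dependency $\mathbf{a}$ with $|M_{\mathbf{a}}|=2k$ and every $(k+1)$-element submultiset $M\subseteq M_{\mathbf{a}}$ containing $+F_{\min(\mathbf{a})}$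 at least twice: $\prod_{F\in M}x_F-z^2\prod_{F\in M_{\mathbf{a}}\setminus M}x_{\overline F}$. (4) For every $i\in[s]$: $x_{F_i^+}x_{F_i^-}-z^2$.
   Context: For $A\in\mathbb{Z}^{m\times s}$, $\mathcal{P}_A=\operatorname{conv}$ of the columns of $A$ and $-A$. $A$ is saturated if every lattice point of $\mathcal{P}_A$ other than the origin occurs exactly once as a column of the matrix $[A\,|\,-A]$. The toric ideal: with one variable $x_\alpha$ per lattice point $\alpha\in\mathcal{P}_A\cap\mathbb{Z}^m$, $I_{\mathcal{P}_A}$ is the kernel of $x_\alpha\mapsto t^\alpha s$ into $\mathbb{K}[t_1^{\pm1},\dots,t_m^{\pm1},s]$; here $z$ is the variable of the origin, $x_{F_i^+}$ that of $F_i$ and $x_{F_i^-}$ that of $-F_i$. Degrevlex with $y_1\prec\dots\prec y_N$: $y^\alpha\prec y^\beta$ iff $\sum\alpha_i<\sum\beta_i$, or the sums are equal and $\alpha_\ell>\beta_\ell$ for $\ell=\min\{j:\alpha_j\ne\beta_j\}$. A minimal linear dependency is a nonzero $\mathbf{a}\in\ker_{\mathbb{Z}}A$ such that no $\mathbf{a}'\in\ker_{\mathbb{Z}}A$, $\mathbf{a}'\ne\mathbf{a}$, satisfies $\operatorname{sign}(\mathbf{a}'_i)=\operatorname{sign}(\mathbf{a}_i)$ and $|\mathbf{a}'_i|\le|\mathbf{a}_i|$ for all $i$. $M_{\mathbf{a}}$ is the multiset of signed columns containing $\operatorname{sign}(\mathbf{a}_\ell)F_\ell$ with multiplicity $|\mathbf{a}_\ell|$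 for each $\ell$ in the support of $\mathbf{a}$ (so $|M_{\mathbf{a}}|=\sum|\mathbf{a}_\ell|$); $\min(\mathbf{a})$ is the smallest index in the support of $\mathbf{a}$. For a signed column, $x_{+F_i}:=x_{F_i^+}$, $x_{-F_i}:=x_{F_i^-}$, and $\overline{\pm F_i}:=\mp F_i$. A Gröbner basis is a generating set whose initial terms generate the initial ideal. *)

theory Defs
  imports
    "HOL-Analysis.Analysis"
    "HOL-Algebra.Ideal"
    "HOL-Library.Poly_Mapping"
    "HOL-Library.Multiset"
begin

text \<open>
  Polynomials in variables of type \<open>'v\<close> are elements of the monoid algebra over the exponent
  vectors \<open>'v \<Rightarrow>\<^sub>0 nat\<close>.  In this file the variables are lattice points, the variable
  \<open>x\<^sub>\<alpha>\<close> being identified with \<open>\<alpha> :: int ^ 'm\<close>.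
\<close>

type_synonym ('v, 'k) mpoly = "('v \<Rightarrow>\<^sub>0 nat) \<Rightarrow>\<^sub>0 'k"

definition Var :: "'v \<Rightarrow> ('v, 'k::comm_ring_1) mpoly" where
  "Var v = Poly_Mapping.single (Poly_Mapping.single v 1) 1"

definition mpoly_ring :: "'v set \<Rightarrow> ('v, 'k::comm_ring_1) mpoly ring" where
  "mpoly_ring V =
    \<lparr>carrier = {p. \<forall>\<mu>\<in>Poly_Mapping.keys p. Poly_Mapping.keys \<mu> \<subseteq> V},
     mult = (*), one = 1, zero = 0, add = (+)\<rparr>"


subsection \<open>Degree reverse lexicographic order, initial terms, Groebner bases\<close>

text \<open>
  The list \<open>ys\<close> enumerates the variables from the smallest to the largest; monomials are
  represented by their exponent vectors.
\<close>

definition degrevlex_less :: "'v list \<Rightarrow> ('v \<Rightarrow>\<^sub>0 nat) \<Rightarrow> ('v \<Rightarrow>\<^sub>0 nat) \<Rightarrow> bool" where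
  "degrevlex_less ys \<mu> \<nu> \<longleftrightarrow>
     (\<Sum>y\<leftarrow>ys. Poly_Mapping.lookup \<mu> y) < (\<Sum>y\<leftarrow>ys. Poly_Mapping.lookup \<nu> y) \<or>
     (\<Sum>y\<leftarrow>ys. Poly_Mapping.lookup \<mu> y) = (\<Sum>y\<leftarrow>ys. Poly_Mapping.lookup \<nu> y) \<and>
     (\<exists>l<length ys. Poly_Mapping.lookup \<mu> (ys ! l) > Poly_Mapping.lookup \<nu> (ys ! l) \<and>
        (\<forall>j<l. Poly_Mapping.lookup \<mu> (ys ! j) = Poly_Mapping.lookup \<nu> (ys ! j)))"

text \<open>A relation rather than a function, so that the zero polynomial has no initial term.\<close>

definition is_initial_term ::
  "(('v \<Rightarrow>\<^sub>0 nat) \<Rightarrow> ('v \<Rightarrow>\<^sub>0 nat) \<Rightarrow> bool) \<Rightarrow> ('v, 'k::comm_ring_1) mpoly \<Rightarrow> ('v, 'k) mpoly \<Rightarrow> bool"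
  where
  "is_initial_term prec p t \<longleftrightarrow>
     (\<exists>\<mu>\<in>Poly_Mapping.keys p. (\<forall>\<nu>\<in>Poly_Mapping.keys p. \<nu> \<noteq> \<mu> \<longrightarrow> prec \<nu> \<mu>) \<and>
        t = Poly_Mapping.single \<mu> (Poly_Mapping.lookup p \<mu>))"

definition initial_terms ::
  "(('v \<Rightarrow>\<^sub>0 nat) \<Rightarrow> ('v \<Rightarrow>\<^sub>0 nat) \<Rightarrow> bool) \<Rightarrow> ('v, 'k::comm_ring_1) mpoly set \<Rightarrow> ('v, 'k) mpoly set"
  where
  "initial_terms prec G = {t. \<exists>g\<in>G. is_initial_term prec g t}"

definition initial_ideal ::
  "'v set \<Rightarrow> (('v \<Rightarrow>\<^sub>0 nat) \<Rightarrow> ('v \<Rightarrow>\<^sub>0 nat) \<Rightarrow> bool) \<Rightarrow> ('v, 'k::comm_ring_1) mpoly set \<Rightarrow>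
   ('v, 'k) mpoly set" where
  "initial_ideal V prec I = genideal (mpoly_ring V) (initial_terms prec I)"

definition groebner_basis ::
  "'v set \<Rightarrow> (('v \<Rightarrow>\<^sub>0 nat) \<Rightarrow> ('v \<Rightarrow>\<^sub>0 nat) \<Rightarrow> bool) \<Rightarrow> ('v, 'k::comm_ring_1) mpoly set \<Rightarrow>
   ('v, 'k) mpoly set \<Rightarrow> bool" where
  "groebner_basis V prec I G \<longleftrightarrow>
     G \<subseteq> I \<and> genideal (mpoly_ring V) G = I \<and>
     genideal (mpoly_ring V) (initial_terms prec G) = initial_ideal V prec I"


subsection \<open>Lattice points and the toric ideal\<close>

definition real_vec :: "int ^ 'm \<Rightarrow> real ^ 'm" where
  "real_vec v = (\<chi> i. real_of_int (v $ i))"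

definition lattice_points :: "(real ^ 'm) set \<Rightarrow> (int ^ 'm) set" where
  "lattice_points P = {\<alpha>. real_vec \<alpha> \<in> P}"

text \<open>
  The ring \<open>\<bbbK>[t\<^sub>1\<^sup>\<plusminus>, \<dots>, t\<^sub>m\<^sup>\<plusminus>, s]\<close> is the
  monoid algebra of \<open>\<int>\<^sup>m \<times> \<nat>\<close>; the monomial \<open>t\<^sup>\<beta> s\<^sup>d\<close>
  is \<open>single (\<beta>, d) 1\<close>.
\<close>

definition toric_map ::
  "(int ^ 'm::finite, 'k::comm_ring_1) mpoly \<Rightarrow> ((int ^ 'm) \<times> nat) \<Rightarrow>\<^sub>0 'k" where
  "toric_map p =
     (\<Sum>\<mu>\<in>Poly_Mapping.keys p. Poly_Mapping.single 0 (Poly_Mapping.lookup p \<mu>) *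
        (\<Prod>\<alpha>\<in>Poly_Mapping.keys \<mu>. Poly_Mapping.single (\<alpha>, 1) 1 ^ Poly_Mapping.lookup \<mu> \<alpha>))"

definition toric_ideal :: "(real ^ 'm::finite) set \<Rightarrow> (int ^ 'm, 'k::comm_ring_1) mpoly set" where
  "toric_ideal P = {p \<in> carrier (mpoly_ring (lattice_points P)). toric_map p = 0}"


subsection \<open>The matrix, its polytope, and minimal linear dependencies\<close>

text \<open>The block matrix \<open>[A | -A]\<close>.\<close>

definition sym_matrix :: "int ^ 's ^ 'm \<Rightarrow> int ^ ('s + 's) ^ 'm" where
  "sym_matrix A = (\<chi> i j. case j of Inl k \<Rightarrow> A $ i $ k | Inr k \<Rightarrow> - (A $ i $ k))"

definition polytope_of :: "int ^ 's ^ 'm \<Rightarrow> (real ^ 'm) set" where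
  "polytope_of A = convex hull (real_vec ` columns (sym_matrix A))"

definition saturated :: "int ^ 's ^ 'm \<Rightarrow> bool" where
  "saturated A \<longleftrightarrow>
     (\<forall>\<alpha>\<in>lattice_points (polytope_of A). \<alpha> \<noteq> 0 \<longrightarrow> (\<exists>!j. column j (sym_matrix A) = \<alpha>))"

text \<open>The variables from the smallest to the largest: \<open>0, F\<^sub>1, -F\<^sub>1, \<dots>, F\<^sub>s, -F\<^sub>s\<close>.\<close>

definition variables :: "int ^ 's::{finite, linorder} ^ 'm \<Rightarrow> (int ^ 'm) list" where
  "variables A =
     0 # concat (map (\<lambda>j. [column j A, - column j A]) (sorted_list_of_set UNIV))"

definition minimal_dependency :: "int ^ 's ^ 'm \<Rightarrow> int ^ 's \<Rightarrow> bool" where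
  "minimal_dependency A a \<longleftrightarrow>
     a \<noteq> 0 \<and> A *v a = 0 \<and>
     \<not> (\<exists>a'. A *v a' = 0 \<and> a' \<noteq> a \<and> (\<forall>i. sgn (a' $ i) = sgn (a $ i) \<and> \<bar>a' $ i\<bar> \<le> \<bar>a $ i\<bar>))"

definition min_index :: "int ^ 's::{finite, linorder} \<Rightarrow> 's" where
  "min_index a = Min {i. a $ i \<noteq> 0}"

text \<open>
  A signed column \<open>\<plusminus>F\<^sub>i\<close> is represented by the lattice point it denotes, so its
  variable is \<open>Var\<close> of that point and the bar operation is negation.  For a saturated matrix
  without zero columns, distinct signed columns are distinct lattice points.
\<close>

definition dep_mset :: "int ^ 's ^ 'm \<Rightarrow> int ^ 's \<Rightarrow> (int ^ 'm) multiset" where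
  "dep_mset A a = (\<Sum>l\<in>UNIV. replicate_mset (nat \<bar>a $ l\<bar>) (sgn (a $ l) *s column l A))"

definition mset_monomial :: "'v multiset \<Rightarrow> ('v, 'k::comm_ring_1) mpoly" where
  "mset_monomial M = (\<Prod>F\<in>#M. Var F)"


subsection \<open>The binomials\<close>

text \<open>
  Each binomial is recorded as the pair of its first (positive) and second (negative) monomial.
\<close>

definition binomials1 ::
  "int ^ 's::{finite, linorder} ^ 'm \<Rightarrow> ((int ^ 'm, 'k::comm_ring_1) mpoly \<times> (int ^ 'm, 'k) mpoly) set"
  where
  "binomials1 A =
     {(mset_monomial M, mset_monomial (image_mset uminus (dep_mset A a - M))) | a k M.
        minimal_dependency A a \<and> size (dep_mset A a) = 2 * k \<and>
        M \<subseteq># dep_mset A a \<and> size M = k \<and>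
        (a $ min_index a > 0 \<longrightarrow> column (min_index a) A \<notin># M) \<and>
        (a $ min_index a < 0 \<longrightarrow>
           \<not> replicate_mset (nat \<bar>a $ min_index a\<bar>) (- column (min_index a) A) \<subseteq># M)}"

definition binomials2 ::
  "int ^ 's::{finite, linorder} ^ 'm \<Rightarrow> ((int ^ 'm, 'k::comm_ring_1) mpoly \<times> (int ^ 'm, 'k) mpoly) set"
  where
  "binomials2 A =
     {(mset_monomial M, Var 0 * mset_monomial (image_mset uminus (dep_mset A a - M))) | a k M.
        minimal_dependency A a \<and> size (dep_mset A a) = 2 * k + 1 \<and>
        M \<subseteq># dep_mset A a \<and> size M = k + 1}"

definition binomials3 ::
  "int ^ 's::{finite, linorder} ^ 'm \<Rightarrow> ((int ^ 'm, 'k::comm_ring_1) mpoly \<times> (int ^ 'm, 'k) mpoly) set"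
  where
  "binomials3 A =
     {(mset_monomial M, Var 0 ^ 2 * mset_monomial (image_mset uminus (dep_mset A a - M))) | a k M.
        minimal_dependency A a \<and> size (dep_mset A a) = 2 * k \<and>
        M \<subseteq># dep_mset A a \<and> size M = k + 1 \<and>
        count M (column (min_index a) A) \<ge> 2}"

definition binomials4 ::
  "int ^ 's::{finite, linorder} ^ 'm \<Rightarrow> ((int ^ 'm, 'k::comm_ring_1) mpoly \<times> (int ^ 'm, 'k) mpoly) set"
  where
  "binomials4 A = {(Var (column i A) * Var (- column i A), Var 0 ^ 2) | i. True}"

definition binomials ::
  "int ^ 's::{finite, linorder} ^ 'm \<Rightarrow> ((int ^ 'm, 'k::comm_ring_1) mpoly \<times> (int ^ 'm, 'k) mpoly) set"
  where
  "binomials A = binomials1 A \<union> binomials2 A \<union> binomials3 A \<union> binomials4 A"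

end

theory Submission
  imports Defs
begin

text \<open>
  Let \<open>u - v\<close> be a homogeneous binomial of the toric ideal with \<open>v \<prec> u\<close>; it suffices to find a
  listed binomial whose first monomial divides \<open>u\<close>.  If \<open>u\<close> contains some
  \<open>x\<^bsub>F\<^esub> x\<^bsub>-F\<^esub>\<close>, (4) applies.  Otherwise the difference of the two exponent vectors gives an
  integer dependency \<open>b\<close>, and the part of \<open>u\<close> that is not cancelled by \<open>v\<close> is a submultiset
  \<open>U\<close> of \<open>M\<^sub>b\<close>.  The inequality \<open>v \<prec> u\<close> says that \<open>U\<close> has more than half of the elements of
  \<open>M\<^sub>b\<close>, or exactly half of them and satisfies the sign conditions (a), (b) at the least index of
  \<open>b\<close>.  Splitting \<open>b\<close> into sign-compatible dependencies \<open>b' + b''\<close> splits \<open>U\<close>, and one of the two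
  parts inherits this property; hence one may take \<open>b\<close> minimal, and then a submultiset of \<open>U\<close>
  of the right size gives a binomial of type (1), (2) or (3).
\<close>

subsection \<open>Polynomials and pushforwards\<close>

lemma poly_eq_sum_monomials:
  fixes p :: "'a \<Rightarrow>\<^sub>0 'k::comm_monoid_add"
  shows "p = (\<Sum>\<mu>\<in>Poly_Mapping.keys p. Poly_Mapping.single \<mu> (Poly_Mapping.lookup p \<mu>))"
proof (rule poly_mapping_eqI)
  fix k
  show "Poly_Mapping.lookup p k =
    Poly_Mapping.lookup (\<Sum>\<mu>\<in>Poly_Mapping.keys p. Poly_Mapping.single \<mu> (Poly_Mapping.lookup p \<mu>)) k"
    by (simp add: lookup_sum lookup_single when_def in_keys_iff)
qed

text \<open>The map of monoid algebras induced by \<open>f\<close> on exponents. It is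
  multiplicative whenever \<open>f\<close> is additive, so the toric ideal becomes one instance of a
  kernel of such a map.\<close>

definition pushforward :: "('a \<Rightarrow> 'b) \<Rightarrow> ('a \<Rightarrow>\<^sub>0 'k::comm_monoid_add) \<Rightarrow> ('b \<Rightarrow>\<^sub>0 'k)" where
  "pushforward f p = (\<Sum>\<mu>\<in>Poly_Mapping.keys p. Poly_Mapping.single (f \<mu>) (Poly_Mapping.lookup p \<mu>))"

lemma pushforward_add: "pushforward f (p + q) = pushforward f p + pushforward f q"
  unfolding pushforward_def
  by (rule setsum_keys_plus_distrib) (simp_all add: single_add)

lemma pushforward_zero [simp]: "pushforward f 0 = 0"
  by (simp add: pushforward_def)

lemma pushforward_single [simp]: "pushforward f (Poly_Mapping.single \<mu> c) = Poly_Mapping.single (f \<mu>) c"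
  by (simp add: pushforward_def)

lemma pushforward_sum: "pushforward f (sum g S) = (\<Sum>x\<in>S. pushforward f (g x))"
  by (induction S rule: infinite_finite_induct) (auto simp: pushforward_add)

lemma pushforward_uminus:
  fixes p :: "'a \<Rightarrow>\<^sub>0 'k::ab_group_add"
  shows "pushforward f (- p) = - pushforward f p"
  using pushforward_add[of f p "- p"] by (simp add: eq_neg_iff_add_eq_0 add.commute)

lemma pushforward_diff:
  fixes p :: "'a \<Rightarrow>\<^sub>0 'k::ab_group_add"
  shows "pushforward f (p - q) = pushforward f p - pushforward f q"
  using pushforward_add[of f p "- q"] by (simp add: pushforward_uminus)

lemma pushforward_mult:
  fixes p q :: "'a::comm_monoid_add \<Rightarrow>\<^sub>0 'k::comm_ring_1"
    and f :: "'a \<Rightarrow> 'b::comm_monoid_add"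
  assumes "\<And>x y. f (x + y) = f x + f y"
  shows "pushforward f (p * q) = pushforward f p * pushforward f q"
proof -
  have "p * q = (\<Sum>\<mu>\<in>Poly_Mapping.keys p. \<Sum>\<nu>\<in>Poly_Mapping.keys q.
      Poly_Mapping.single (\<mu> + \<nu>) (Poly_Mapping.lookup p \<mu> * Poly_Mapping.lookup q \<nu>))"
    using arg_cong2[OF poly_eq_sum_monomials[of p] poly_eq_sum_monomials[of q], of "(*)"]
    by (simp only: sum_product mult_single)
  then have "pushforward f (p * q) = (\<Sum>\<mu>\<in>Poly_Mapping.keys p. \<Sum>\<nu>\<in>Poly_Mapping.keys q.
      Poly_Mapping.single (f \<mu> + f \<nu>) (Poly_Mapping.lookup p \<mu> * Poly_Mapping.lookup q \<nu>))"
    by (simp add: pushforward_sum assms)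
  also have "\<dots> = pushforward f p * pushforward f q"
    by (simp add: pushforward_def sum_product mult_single)
  finally show ?thesis .
qed

lemma lookup_pushforward:
  "Poly_Mapping.lookup (pushforward f p) w =
     (\<Sum>\<mu>\<in>{\<mu>\<in>Poly_Mapping.keys p. f \<mu> = w}. Poly_Mapping.lookup p \<mu>)"
  by (simp add: pushforward_def lookup_sum lookup_single when_def sum.If_cases Int_def)

section \<open>The polynomial ring over \<open>V\<close> and its ideals\<close>

lemma mpoly_ring_simps [simp]:
  "mult (mpoly_ring V) = (*)" "one (mpoly_ring V) = 1"
  "zero (mpoly_ring V) = 0" "add (mpoly_ring V) = (+)"
  by (simp_all add: mpoly_ring_def)

lemma carrier_mpoly_ring:
  "p \<in> carrier (mpoly_ring V) \<longleftrightarrow> (\<forall>\<mu>\<in>Poly_Mapping.keys p. Poly_Mapping.keys \<mu> \<subseteq> V)"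
  by (simp add: mpoly_ring_def)

lemma carrier_mpoly_ring_uminus:
  "p \<in> carrier (mpoly_ring V) \<Longrightarrow> - p \<in> carrier (mpoly_ring V)"
  by (auto simp: carrier_mpoly_ring in_keys_iff)

lemma carrier_mpoly_ring_add:
  "p \<in> carrier (mpoly_ring V) \<Longrightarrow> q \<in> carrier (mpoly_ring V) \<Longrightarrow> p + q \<in> carrier (mpoly_ring V)"
  using keys_add[of p q] unfolding carrier_mpoly_ring by blast

lemma carrier_mpoly_ring_mult:
  assumes "p \<in> carrier (mpoly_ring V)" "q \<in> carrier (mpoly_ring V)"
  shows "p * q \<in> carrier (mpoly_ring V)"
  unfolding carrier_mpoly_ring
proof
  fix \<mu> assume "\<mu> \<in> Poly_Mapping.keys (p * q)"
  then obtain \<alpha> \<beta> where *: "\<alpha> \<in> Poly_Mapping.keys p" "\<beta> \<in> Poly_Mapping.keys q" "\<mu> = \<alpha> + \<beta>"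
    using keys_mult[of p q] by blast
  then show "Poly_Mapping.keys \<mu> \<subseteq> V"
    using keys_add[of \<alpha> \<beta>] assms unfolding carrier_mpoly_ring by blast
qed

lemma carrier_mpoly_ring_single:
  "Poly_Mapping.keys \<mu> \<subseteq> V \<Longrightarrow> Poly_Mapping.single \<mu> c \<in> carrier (mpoly_ring V)"
  by (auto simp: carrier_mpoly_ring split: if_splits)

lemma carrier_mpoly_ring_diff:
  "p \<in> carrier (mpoly_ring V) \<Longrightarrow> q \<in> carrier (mpoly_ring V) \<Longrightarrow> p - q \<in> carrier (mpoly_ring V)"
  using carrier_mpoly_ring_add[of p V "- q"] carrier_mpoly_ring_uminus[of q V] by simp

lemma ring_mpoly_ring: "ring (mpoly_ring V :: ('v, 'k::comm_ring_1) mpoly ring)"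
proof (rule ringI)
  show "abelian_group (mpoly_ring V :: ('v, 'k) mpoly ring)"
  proof (rule abelian_groupI)
    fix x :: "('v, 'k) mpoly"
    assume "x \<in> carrier (mpoly_ring V)"
    then show "\<exists>y\<in>carrier (mpoly_ring V). y \<oplus>\<^bsub>mpoly_ring V\<^esub> x = \<zero>\<^bsub>mpoly_ring V\<^esub>"
      by (intro bexI[of _ "- x"]) (auto simp: carrier_mpoly_ring_uminus)
  qed (auto simp: carrier_mpoly_ring_add algebra_simps, auto simp: carrier_mpoly_ring)
  show "Group.monoid (mpoly_ring V :: ('v, 'k) mpoly ring)"
    by (unfold_locales, auto simp: carrier_mpoly_ring_mult algebra_simps)
       (auto simp: carrier_mpoly_ring)
qed (auto simp: algebra_simps)

lemma ideal_mpoly_ringI: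
  fixes I :: "('v, 'k::comm_ring_1) mpoly set"
  assumes sub: "I \<subseteq> carrier (mpoly_ring V)" and zero: "0 \<in> I"
    and add: "\<And>p q. p \<in> I \<Longrightarrow> q \<in> I \<Longrightarrow> p + q \<in> I"
    and mult: "\<And>p q. p \<in> carrier (mpoly_ring V) \<Longrightarrow> q \<in> I \<Longrightarrow> p * q \<in> I"
  shows "ideal I (mpoly_ring V)"
proof (rule idealI[OF ring_mpoly_ring])
  interpret ring "mpoly_ring V :: ('v, 'k) mpoly ring" by (rule ring_mpoly_ring)
  \<comment> \<open>Closure under negation comes from multiplying by the constant
    \<open>-1\<close>.\<close>
  have minus: "- p \<in> I" if "p \<in> I" for p
    using mult[of "-1" p] that carrier_mpoly_ring_uminus[of "1 :: ('v, 'k) mpoly" V]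
    by (auto simp: carrier_mpoly_ring)
  show "subgroup I (add_monoid (mpoly_ring V))"
  proof (rule add.subgroupI)
    fix a assume a: "a \<in> I"
    then have "\<ominus>\<^bsub>mpoly_ring V\<^esub> a = - a"
      using sub carrier_mpoly_ring_uminus[of a V] by (intro minus_equality) auto
    then show "\<ominus>\<^bsub>mpoly_ring V\<^esub> a \<in> I"
      using minus[OF a] by simp
  qed (use sub zero add in auto)
  show "x \<otimes>\<^bsub>mpoly_ring V\<^esub> a \<in> I" "a \<otimes>\<^bsub>mpoly_ring V\<^esub> x \<in> I"
    if "a \<in> I" "x \<in> carrier (mpoly_ring V)" for a x
    using mult[OF that(2,1)] by (simp_all add: Groups.mult.commute)
qed

lemma mpoly_ideal_closed:
  fixes I :: "('v, 'k::comm_ring_1) mpoly set"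
  assumes "ideal I (mpoly_ring V)"
  shows "0 \<in> I" and "p \<in> I \<Longrightarrow> q \<in> I \<Longrightarrow> p + q \<in> I"
    and "p \<in> carrier (mpoly_ring V) \<Longrightarrow> q \<in> I \<Longrightarrow> p * q \<in> I"
    and "p \<in> I \<Longrightarrow> q \<in> I \<Longrightarrow> p - q \<in> I"
proof -
  interpret ideal I "mpoly_ring V" by (rule assms)
  note sg = ideal.axioms(1)[OF assms]
  show 0: "0 \<in> I" using additive_subgroup.zero_closed[OF sg] by simp
  show add: "p + q \<in> I" if "p \<in> I" "q \<in> I" for p q
    using additive_subgroup.a_closed[OF sg that] by simp
  show mult: "p * q \<in> I" if "p \<in> carrier (mpoly_ring V)" "q \<in> I" for p q
    using I_l_closed[OF that(2,1)] by simp
  have "- 1 \<in> carrier (mpoly_ring V :: ('v, 'k) mpoly ring)"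
    by (rule carrier_mpoly_ring_uminus) (simp add: carrier_mpoly_ring)
  from mult[OF this, of q] show "p - q \<in> I" if "p \<in> I" "q \<in> I"
    using add[OF that(1), of "- q"] that by simp
qed

lemma mpoly_ideal_sum:
  fixes I :: "('v, 'k::comm_ring_1) mpoly set"
  assumes "ideal I (mpoly_ring V)" "\<And>x. x \<in> S \<Longrightarrow> f x \<in> I"
  shows "sum f S \<in> I"
  using assms(2)
  by (induction S rule: infinite_finite_induct) (auto intro!: mpoly_ideal_closed[OF assms(1)])

lemma ideal_pushforward_kernel:
  fixes f :: "('v \<Rightarrow>\<^sub>0 nat) \<Rightarrow> 'b::comm_monoid_add"
  assumes "\<And>x y. f (x + y) = f x + f y"
  shows "ideal {p \<in> carrier (mpoly_ring V :: ('v, 'k::comm_ring_1) mpoly ring). pushforward f p = 0} (mpoly_ring V)"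
  by (rule ideal_mpoly_ringI)
     (auto simp: pushforward_add pushforward_mult[OF assms] carrier_mpoly_ring_add carrier_mpoly_ring_mult,
      auto simp: carrier_mpoly_ring)


subsection \<open>The degree reverse lexicographic order\<close>

lemma degrevlex_irrefl: "\<not> degrevlex_less ys \<mu> \<mu>"
  by (simp add: degrevlex_less_def)

lemma degrevlex_trans:
  assumes "degrevlex_less ys \<mu> \<nu>" "degrevlex_less ys \<nu> \<rho>"
  shows "degrevlex_less ys \<mu> \<rho>"
proof -
  let ?D = "\<lambda>\<mu>. \<Sum>y\<leftarrow>ys. Poly_Mapping.lookup \<mu> y"
  consider "?D \<mu> < ?D \<rho>" | "?D \<mu> = ?D \<nu>" "?D \<nu> = ?D \<rho>"
    using assms unfolding degrevlex_less_def by linarith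
  then show ?thesis
  proof cases
    case 2
    then obtain k l where k: "k < length ys" "Poly_Mapping.lookup \<mu> (ys ! k) > Poly_Mapping.lookup \<nu> (ys ! k)"
        "\<forall>j<k. Poly_Mapping.lookup \<mu> (ys ! j) = Poly_Mapping.lookup \<nu> (ys ! j)"
      and l: "l < length ys" "Poly_Mapping.lookup \<nu> (ys ! l) > Poly_Mapping.lookup \<rho> (ys ! l)"
        "\<forall>j<l. Poly_Mapping.lookup \<nu> (ys ! j) = Poly_Mapping.lookup \<rho> (ys ! j)"
      using assms unfolding degrevlex_less_def by auto
    \<comment> \<open>The first difference between \<mu> and \<rho> sits at the earlier of the two
      given first differences.\<close>
    have "min k l < length ys" using k(1) by simp
    moreover have "Poly_Mapping.lookup \<mu> (ys ! min k l) > Poly_Mapping.lookup \<rho> (ys ! min k l)"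
      using k l by (cases k l rule: linorder_cases) (auto simp: min_def)
    moreover have "\<forall>j<min k l. Poly_Mapping.lookup \<mu> (ys ! j) = Poly_Mapping.lookup \<rho> (ys ! j)"
      using k l by auto
    ultimately show ?thesis
      using 2 unfolding degrevlex_less_def by auto
  qed (simp add: degrevlex_less_def)
qed

lemma degrevlex_total:
  assumes "Poly_Mapping.keys \<mu> \<subseteq> set ys" "Poly_Mapping.keys \<nu> \<subseteq> set ys" "\<mu> \<noteq> \<nu>"
  shows "degrevlex_less ys \<mu> \<nu> \<or> degrevlex_less ys \<nu> \<mu>"
proof -
  let ?N = "\<lambda>l. l < length ys \<and> Poly_Mapping.lookup \<mu> (ys ! l) \<noteq> Poly_Mapping.lookup \<nu> (ys ! l)"
  have "\<exists>x. Poly_Mapping.lookup \<mu> x \<noteq> Poly_Mapping.lookup \<nu> x"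
    using assms(3) by (meson poly_mapping_eqI)
  then obtain x where x: "Poly_Mapping.lookup \<mu> x \<noteq> Poly_Mapping.lookup \<nu> x" by blast
  \<comment> \<open>A variable with differing exponents lies in one of the supports, hence in
    \<open>ys\<close>. The least index of such a variable decides the comparison when the degrees
    tie.\<close>
  then have "x \<in> set ys" using assms(1,2) by (metis in_keys_iff subsetD)
  with x have "\<exists>l. ?N l" by (metis in_set_conv_nth)
  then obtain l where l: "?N l" "\<forall>j<l. \<not> ?N j"
    using exists_least_iff[of ?N] by blast
  then have "\<forall>j<l. Poly_Mapping.lookup \<mu> (ys ! j) = Poly_Mapping.lookup \<nu> (ys ! j)"
    using less_trans by blast
  then show ?thesis
    using l(1) unfolding degrevlex_less_def
    by (cases "(\<Sum>y\<leftarrow>ys. Poly_Mapping.lookup \<mu> y)" "\<Sum>y\<leftarrow>ys. Poly_Mapping.lookup \<nu> y" rule: linorder_cases;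
        cases "Poly_Mapping.lookup \<mu> (ys ! l)" "Poly_Mapping.lookup \<nu> (ys ! l)" rule: linorder_cases)
       (auto intro!: exI[of _ l])
qed

lemma degrevlex_add_left:
  assumes "degrevlex_less ys \<mu> \<nu>"
  shows "degrevlex_less ys (\<rho> + \<mu>) (\<rho> + \<nu>)"
  using assms by (simp add: degrevlex_less_def lookup_add sum_list_addf)

text \<open>The list is given by its splitting at the deciding variable, so that applications
  involve no index arithmetic.\<close>

lemma degrevlex_first_difference:
  assumes "ys = zs @ y # ws"
    and "(\<Sum>y\<leftarrow>ys. Poly_Mapping.lookup \<mu> y) = (\<Sum>y\<leftarrow>ys. Poly_Mapping.lookup \<nu> y)"
    and "\<And>x. x \<in> set zs \<Longrightarrow> Poly_Mapping.lookup \<mu> x = Poly_Mapping.lookup \<nu> x"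
    and "Poly_Mapping.lookup \<mu> y > Poly_Mapping.lookup \<nu> y"
  shows "degrevlex_less ys \<mu> \<nu>"
proof -
  have "length zs < length ys" "ys ! length zs = y" "\<forall>j<length zs. ys ! j \<in> set zs"
    using assms(1) by (auto simp: nth_append)
  then show ?thesis
    using assms(2-4) unfolding degrevlex_less_def by metis
qed

lemma is_initial_term_binomial:
  assumes "prec \<nu> \<mu>" "\<nu> \<noteq> \<mu>"
  shows "is_initial_term prec (Poly_Mapping.single \<mu> 1 - Poly_Mapping.single \<nu> 1)
           (Poly_Mapping.single \<mu> (1 :: 'k::comm_ring_1))"
  unfolding is_initial_term_def
proof (rule bexI[of _ \<mu>])
  show "\<mu> \<in> Poly_Mapping.keys (Poly_Mapping.single \<mu> 1 - Poly_Mapping.single \<nu> (1 :: 'k))"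
    using assms(2) by (simp add: in_keys_iff lookup_minus lookup_single when_def)
  have "Poly_Mapping.keys (Poly_Mapping.single \<mu> 1 - Poly_Mapping.single \<nu> (1 :: 'k)) \<subseteq> {\<mu>, \<nu>}"
    by (auto simp: in_keys_iff lookup_minus lookup_single when_def split: if_splits)
  then show "(\<forall>\<nu>'\<in>Poly_Mapping.keys (Poly_Mapping.single \<mu> 1 - Poly_Mapping.single \<nu> (1 :: 'k)).
      \<nu>' \<noteq> \<mu> \<longrightarrow> prec \<nu>' \<mu>) \<and> Poly_Mapping.single \<mu> 1 =
      Poly_Mapping.single \<mu> (Poly_Mapping.lookup (Poly_Mapping.single \<mu> 1 - Poly_Mapping.single \<nu> (1 :: 'k)) \<mu>)"
    using assms by (auto simp: lookup_minus lookup_single when_def)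
qed

text \<open>Every exponent is bounded by \<open>d\<close> and vanishes off \<open>V\<close>, so the
  exponent vectors embed into a finite set of functions.\<close>

lemma finite_monomials_of_degree:
  assumes "finite V"
  shows "finite {\<mu> :: 'v \<Rightarrow>\<^sub>0 nat. Poly_Mapping.keys \<mu> \<subseteq> V \<and> (\<Sum>x\<in>V. Poly_Mapping.lookup \<mu> x) = d}"
    (is "finite ?M")
proof -
  have "Poly_Mapping.lookup ` ?M \<subseteq> {f. \<forall>x. (x \<in> V \<longrightarrow> f x \<in> {..d}) \<and> (x \<notin> V \<longrightarrow> f x = 0)}"
  proof clarify
    fix \<mu> :: "'v \<Rightarrow>\<^sub>0 nat" and x
    assume *: "Poly_Mapping.keys \<mu> \<subseteq> V" "d = (\<Sum>x\<in>V. Poly_Mapping.lookup \<mu> x)"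
    then show "(x \<in> V \<longrightarrow> Poly_Mapping.lookup \<mu> x \<in> {..\<Sum>x\<in>V. Poly_Mapping.lookup \<mu> x}) \<and>
        (x \<notin> V \<longrightarrow> Poly_Mapping.lookup \<mu> x = 0)"
      by (auto simp: in_keys_iff intro: member_le_sum[OF _ _ assms])
  qed
  moreover have "finite {f. \<forall>x. (x \<in> V \<longrightarrow> f x \<in> {..d}) \<and> (x \<notin> V \<longrightarrow> f x = 0)}"
    by (rule finite_set_of_finite_funs) (use assms in auto)
  ultimately have "finite (Poly_Mapping.lookup ` ?M)" by (rule finite_subset)
  moreover have "inj_on Poly_Mapping.lookup ?M" by (rule inj_onI) (rule iffD2[OF poly_mapping_eq_iff])
  ultimately show ?thesis by (rule finite_imageD)
qed

text \<open>Rewriting both monomials of a homogeneous binomial downwards terminates, because there are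
  only finitely many monomials of a given degree.\<close>

lemma binomial_in_ideal:
  fixes B :: "(('v \<Rightarrow>\<^sub>0 nat) \<times> ('v \<Rightarrow>\<^sub>0 nat)) set"
    and f :: "('v \<Rightarrow>\<^sub>0 nat) \<Rightarrow> 'b::comm_monoid_add"
    and J :: "('v, 'k::comm_ring_1) mpoly set"
  assumes ys: "distinct ys" "set ys = V"
    and hom: "\<And>x y. f (x + y) = f x + f y"
    and deg: "\<And>\<mu> \<nu>. Poly_Mapping.keys \<mu> \<subseteq> V \<Longrightarrow> Poly_Mapping.keys \<nu> \<subseteq> V \<Longrightarrow> f \<mu> = f \<nu> \<Longrightarrow>
      (\<Sum>x\<in>V. Poly_Mapping.lookup \<mu> x) = (\<Sum>x\<in>V. Poly_Mapping.lookup \<nu> x)"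
    and B: "\<And>\<mu> \<nu>. (\<mu>, \<nu>) \<in> B \<Longrightarrow> Poly_Mapping.keys \<mu> \<subseteq> V \<and> Poly_Mapping.keys \<nu> \<subseteq> V \<and>
      f \<mu> = f \<nu> \<and> degrevlex_less ys \<nu> \<mu>"
    and lead: "\<And>\<mu> \<nu>. Poly_Mapping.keys \<mu> \<subseteq> V \<Longrightarrow> Poly_Mapping.keys \<nu> \<subseteq> V \<Longrightarrow> f \<mu> = f \<nu> \<Longrightarrow>
      degrevlex_less ys \<nu> \<mu> \<Longrightarrow> \<exists>\<alpha> \<beta> \<rho>. (\<alpha>, \<beta>) \<in> B \<and> \<mu> = \<rho> + \<alpha>"
    and J: "ideal J (mpoly_ring V)"
    and BJ: "\<And>\<mu> \<nu>. (\<mu>, \<nu>) \<in> B \<Longrightarrow> Poly_Mapping.single \<mu> 1 - Poly_Mapping.single \<nu> 1 \<in> J"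
    and \<mu>\<nu>: "Poly_Mapping.keys \<mu> \<subseteq> V" "Poly_Mapping.keys \<nu> \<subseteq> V" "f \<mu> = f \<nu>"
  shows "Poly_Mapping.single \<mu> 1 - Poly_Mapping.single \<nu> 1 \<in> J"
proof -
  \<comment> \<open>The smaller monomials in the same fibre of \<open>f\<close>. By
    \<open>deg\<close> they share one total degree, so the set is finite; its cardinality is the
    termination measure.\<close>
  define below where "below \<mu> = {\<rho>. Poly_Mapping.keys \<rho> \<subseteq> V \<and> f \<rho> = f \<mu> \<and> degrevlex_less ys \<rho> \<mu>}" for \<mu>
  have fin: "finite (below \<mu>)" if "Poly_Mapping.keys \<mu> \<subseteq> V" for \<mu>
  proof (rule finite_subset[OF _ finite_monomials_of_degree[of V "\<Sum>x\<in>V. Poly_Mapping.lookup \<mu> x"]])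
    show "below \<mu> \<subseteq> {\<rho>. Poly_Mapping.keys \<rho> \<subseteq> V \<and>
        (\<Sum>x\<in>V. Poly_Mapping.lookup \<rho> x) = (\<Sum>x\<in>V. Poly_Mapping.lookup \<mu> x)}"
      unfolding below_def by (intro Collect_mono impI conjI deg[OF _ that]) blast+
    show "finite V" using ys(2) by auto
  qed
  have below_less: "card (below \<mu>') < card (below \<mu>)"
    if "Poly_Mapping.keys \<mu> \<subseteq> V" "Poly_Mapping.keys \<mu>' \<subseteq> V" "f \<mu>' = f \<mu>" "degrevlex_less ys \<mu>' \<mu>" for \<mu> \<mu>'
  proof (rule psubset_card_mono[OF fin[OF that(1)]])
    have "below \<mu>' \<subseteq> below \<mu>"
      using that degrevlex_trans unfolding below_def by fastforce
    moreover have "\<mu>' \<in> below \<mu> - below \<mu>'"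
      using that degrevlex_irrefl unfolding below_def by auto
    ultimately show "below \<mu>' \<subset> below \<mu>" by blast
  qed
  have reduce: "\<exists>\<mu>'. Poly_Mapping.keys \<mu>' \<subseteq> V \<and> f \<mu>' = f \<mu> \<and> degrevlex_less ys \<mu>' \<mu> \<and>
      Poly_Mapping.single \<mu> 1 - Poly_Mapping.single \<mu>' 1 \<in> J"
    if "Poly_Mapping.keys \<mu> \<subseteq> V" "Poly_Mapping.keys \<nu> \<subseteq> V" "f \<mu> = f \<nu>" "degrevlex_less ys \<nu> \<mu>" for \<mu> \<nu>
  proof -
    \<comment> \<open>One rewriting step: the factor \<alpha> of \<mu> is replaced by \<beta>, which
      changes \<mu> by a monomial multiple of a binomial in \<open>J\<close>.\<close>
    from lead[OF that] obtain \<alpha> \<beta> \<rho> where *: "(\<alpha>, \<beta>) \<in> B" "\<mu> = \<rho> + \<alpha>" by blast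
    have \<rho>: "Poly_Mapping.keys \<rho> \<subseteq> V"
    proof
      fix x assume "x \<in> Poly_Mapping.keys \<rho>"
      then have "x \<in> Poly_Mapping.keys \<mu>" by (simp add: in_keys_iff *(2) lookup_add)
      then show "x \<in> V" using that(1) by blast
    qed
    have "Poly_Mapping.single \<rho> 1 * (Poly_Mapping.single \<alpha> 1 - Poly_Mapping.single \<beta> 1) \<in> J"
      by (rule mpoly_ideal_closed(3)[OF J carrier_mpoly_ring_single[OF \<rho>] BJ[OF *(1)]])
    then have "Poly_Mapping.single \<mu> 1 - Poly_Mapping.single (\<rho> + \<beta>) 1 \<in> J"
      by (simp add: right_diff_distrib mult_single *(2))
    moreover have "Poly_Mapping.keys (\<rho> + \<beta>) \<subseteq> V"
      using \<rho> B[OF *(1)] keys_add[of \<rho> \<beta>] by blast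
    moreover have "f (\<rho> + \<beta>) = f \<mu>"
      using B[OF *(1)] *(2) hom by simp
    moreover have "degrevlex_less ys (\<rho> + \<beta>) \<mu>"
      using B[OF *(1)] *(2) degrevlex_add_left by blast
    ultimately show ?thesis by blast
  qed
  show ?thesis
    using \<mu>\<nu>
  \<comment> \<open>Either monomial may be the one to be rewritten, so the measure adds both
    cardinalities; the larger monomial is the one that moves.\<close>
  proof (induction "card (below \<mu>) + card (below \<nu>)" arbitrary: \<mu> \<nu> rule: less_induct)
    case less
    consider "\<mu> = \<nu>" | "degrevlex_less ys \<nu> \<mu>" | "degrevlex_less ys \<mu> \<nu>"
      using degrevlex_total less.prems ys(2) by blast
    then show ?case
    proof cases
      case 1
      then show ?thesis using mpoly_ideal_closed(1)[OF J] by simp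
    next
      case 2
      from reduce[OF less.prems 2] obtain \<mu>' where \<mu>': "Poly_Mapping.keys \<mu>' \<subseteq> V" "f \<mu>' = f \<mu>"
        "degrevlex_less ys \<mu>' \<mu>" "Poly_Mapping.single \<mu> 1 - Poly_Mapping.single \<mu>' 1 \<in> J" by blast
      have "Poly_Mapping.single \<mu>' 1 - Poly_Mapping.single \<nu> 1 \<in> J"
        using below_less[of \<mu> \<mu>'] \<mu>' less.prems by (intro less.hyps) auto
      from mpoly_ideal_closed(2)[OF J \<mu>'(4) this] show ?thesis by simp
    next
      case 3
      from reduce[OF less.prems(2,1) less.prems(3)[symmetric] 3] obtain \<nu>' where
        \<nu>': "Poly_Mapping.keys \<nu>' \<subseteq> V" "f \<nu>' = f \<nu>"
        "degrevlex_less ys \<nu>' \<nu>" "Poly_Mapping.single \<nu> 1 - Poly_Mapping.single \<nu>' 1 \<in> J" by blast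
      have "Poly_Mapping.single \<mu> 1 - Poly_Mapping.single \<nu>' 1 \<in> J"
        using below_less[of \<nu> \<nu>'] \<nu>' less.prems by (intro less.hyps) auto
      from mpoly_ideal_closed(4)[OF J this \<nu>'(4)] show ?thesis by simp
    qed
  qed
qed

section \<open>Kernels of monomial maps and a Groebner basis criterion\<close>

lemma kernel_subset_ideal:
  fixes f :: "('v \<Rightarrow>\<^sub>0 nat) \<Rightarrow> 'b" and J :: "('v, 'k::comm_ring_1) mpoly set"
  assumes J: "ideal J (mpoly_ring V)"
    and binom: "\<And>\<mu> \<nu>. Poly_Mapping.keys \<mu> \<subseteq> V \<Longrightarrow> Poly_Mapping.keys \<nu> \<subseteq> V \<Longrightarrow> f \<mu> = f \<nu> \<Longrightarrow>
      Poly_Mapping.single \<mu> 1 - Poly_Mapping.single \<nu> 1 \<in> J"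
    and p: "p \<in> carrier (mpoly_ring V)" "pushforward f p = 0"
  shows "p \<in> J"
proof -
  \<comment> \<open>Choose one monomial in each fibre. Modulo \<open>J\<close> every monomial may be
    replaced by the representative of its fibre.\<close>
  define rep where "rep w = (SOME \<mu>. Poly_Mapping.keys \<mu> \<subseteq> V \<and> f \<mu> = w)" for w
  have rep: "Poly_Mapping.keys (rep (f \<mu>)) \<subseteq> V \<and> f (rep (f \<mu>)) = f \<mu>" if "Poly_Mapping.keys \<mu> \<subseteq> V" for \<mu>
    unfolding rep_def by (rule someI[of _ \<mu>]) (use that in simp)
  let ?c = "Poly_Mapping.lookup p"
  have "Poly_Mapping.single 0 (?c \<mu>) * (Poly_Mapping.single \<mu> 1 - Poly_Mapping.single (rep (f \<mu>)) 1) \<in> J"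
    if "\<mu> \<in> Poly_Mapping.keys p" for \<mu>
  proof (rule mpoly_ideal_closed(3)[OF J])
    show "Poly_Mapping.single 0 (?c \<mu>) \<in> carrier (mpoly_ring V)"
      by (rule carrier_mpoly_ring_single) simp
    have "Poly_Mapping.keys \<mu> \<subseteq> V" using p(1) that by (simp add: carrier_mpoly_ring)
    then show "Poly_Mapping.single \<mu> 1 - Poly_Mapping.single (rep (f \<mu>)) 1 \<in> J"
      using rep by (intro binom) auto
  qed
  then have "(\<Sum>\<mu>\<in>Poly_Mapping.keys p. Poly_Mapping.single 0 (?c \<mu>) *
      (Poly_Mapping.single \<mu> 1 - Poly_Mapping.single (rep (f \<mu>)) 1)) \<in> J"
    by (rule mpoly_ideal_sum[OF J])
  also have "(\<Sum>\<mu>\<in>Poly_Mapping.keys p. Poly_Mapping.single 0 (?c \<mu>) *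
      (Poly_Mapping.single \<mu> 1 - Poly_Mapping.single (rep (f \<mu>)) 1)) =
      p - (\<Sum>\<mu>\<in>Poly_Mapping.keys p. Poly_Mapping.single (rep (f \<mu>)) (?c \<mu>))"
    by (simp add: right_diff_distrib mult_single sum_subtractf flip: poly_eq_sum_monomials)
  \<comment> \<open>After the replacement, coefficients are summed over fibres. These sums are the
    coefficients of \<open>pushforward f p\<close>, which vanish.\<close>
  also have "(\<Sum>\<mu>\<in>Poly_Mapping.keys p. Poly_Mapping.single (rep (f \<mu>)) (?c \<mu>)) =
      pushforward rep (pushforward f p)"
    by (subst (2) pushforward_def) (simp add: pushforward_sum)
  finally show ?thesis using p(2) by simp
qed

text \<open>A monomial alone in its fibre would leave its nonzero coefficient in the pushforward,
  with nothing to cancel it.\<close>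

lemma other_monomial_in_fibre:
  assumes "pushforward f p = 0" "\<mu> \<in> Poly_Mapping.keys p"
  shows "\<exists>\<nu>\<in>Poly_Mapping.keys p. \<nu> \<noteq> \<mu> \<and> f \<nu> = f \<mu>"
proof (rule ccontr)
  assume "\<not> ?thesis"
  then have "{\<nu>\<in>Poly_Mapping.keys p. f \<nu> = f \<mu>} = {\<mu>}" using assms(2) by auto
  then have "Poly_Mapping.lookup (pushforward f p) (f \<mu>) = Poly_Mapping.lookup p \<mu>"
    by (simp add: lookup_pushforward)
  with assms show False by (simp add: in_keys_iff)
qed

text \<open>Condition \<open>lead\<close> speaks only of pairs of monomials, yet it controls all
  initial terms: the initial monomial of a kernel element shares its fibre with a smaller monomial
  of the same polynomial, so some first monomial from \<open>B\<close> divides it. Generation of the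
  kernel comes from the rewriting argument.\<close>

lemma groebner_basis_binomials:
  fixes B :: "(('v \<Rightarrow>\<^sub>0 nat) \<times> ('v \<Rightarrow>\<^sub>0 nat)) set"
    and f :: "('v \<Rightarrow>\<^sub>0 nat) \<Rightarrow> 'b::comm_monoid_add"
  assumes ys: "distinct ys" "set ys = V"
    and hom: "\<And>x y. f (x + y) = f x + f y"
    and deg: "\<And>\<mu> \<nu>. Poly_Mapping.keys \<mu> \<subseteq> V \<Longrightarrow> Poly_Mapping.keys \<nu> \<subseteq> V \<Longrightarrow> f \<mu> = f \<nu> \<Longrightarrow>
      (\<Sum>x\<in>V. Poly_Mapping.lookup \<mu> x) = (\<Sum>x\<in>V. Poly_Mapping.lookup \<nu> x)"
    and B: "\<And>\<mu> \<nu>. (\<mu>, \<nu>) \<in> B \<Longrightarrow> Poly_Mapping.keys \<mu> \<subseteq> V \<and> Poly_Mapping.keys \<nu> \<subseteq> V \<and>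
      f \<mu> = f \<nu> \<and> degrevlex_less ys \<nu> \<mu>"
    and lead: "\<And>\<mu> \<nu>. Poly_Mapping.keys \<mu> \<subseteq> V \<Longrightarrow> Poly_Mapping.keys \<nu> \<subseteq> V \<Longrightarrow> f \<mu> = f \<nu> \<Longrightarrow>
      degrevlex_less ys \<nu> \<mu> \<Longrightarrow> \<exists>\<alpha> \<beta> \<rho>. (\<alpha>, \<beta>) \<in> B \<and> \<mu> = \<rho> + \<alpha>"
  shows "groebner_basis V (degrevlex_less ys)
    {p \<in> carrier (mpoly_ring V :: ('v, 'k::comm_ring_1) mpoly ring). pushforward f p = 0}
    {Poly_Mapping.single \<mu> 1 - Poly_Mapping.single \<nu> 1 | \<mu> \<nu>. (\<mu>, \<nu>) \<in> B}"
    (is "groebner_basis V ?less ?I ?G")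
proof -
  let ?R = "mpoly_ring V :: ('v, 'k) mpoly ring"
  interpret ring ?R by (rule ring_mpoly_ring)
  have I: "ideal ?I ?R" by (rule ideal_pushforward_kernel[OF hom])
  have GI: "?G \<subseteq> ?I"
    using B by (auto simp: pushforward_diff intro!: carrier_mpoly_ring_diff carrier_mpoly_ring_single)
  then have G: "?G \<subseteq> carrier ?R" by blast
  have initG: "initial_terms ?less S \<subseteq> carrier ?R" if "S \<subseteq> carrier ?R" for S
    using that unfolding initial_terms_def is_initial_term_def
    by (auto intro!: carrier_mpoly_ring_single) (metis carrier_mpoly_ring subset_iff)
  have gen: "genideal ?R ?G = ?I"
  proof
    show "genideal ?R ?G \<subseteq> ?I" by (rule genideal_minimal[OF I GI])
    have J: "ideal (genideal ?R ?G) ?R" by (rule genideal_ideal[OF G])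
    show "?I \<subseteq> genideal ?R ?G"
    proof clarify
      fix p :: "('v, 'k) mpoly"
      assume p: "p \<in> carrier ?R" "pushforward f p = 0"
      show "p \<in> genideal ?R ?G"
      proof (rule kernel_subset_ideal[OF J _ p])
        fix \<mu> \<nu> :: "'v \<Rightarrow>\<^sub>0 nat"
        assume *: "Poly_Mapping.keys \<mu> \<subseteq> V" "Poly_Mapping.keys \<nu> \<subseteq> V" "f \<mu> = f \<nu>"
        have BJ: "Poly_Mapping.single \<mu> 1 - Poly_Mapping.single \<nu> 1 \<in> genideal ?R ?G"
          if "(\<mu>, \<nu>) \<in> B" for \<mu> \<nu>
          using genideal_self[OF G] that by blast
        show "Poly_Mapping.single \<mu> 1 - Poly_Mapping.single \<nu> 1 \<in> genideal ?R ?G"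
          by (rule binomial_in_ideal[where B = B and f = f, OF ys hom deg B lead J BJ *])
      qed
    qed
  qed
  have init: "genideal ?R (initial_terms ?less ?G) = initial_ideal V ?less ?I"
    unfolding initial_ideal_def
  proof
    have IG: "initial_terms ?less ?G \<subseteq> initial_terms ?less ?I"
      using GI unfolding initial_terms_def by blast
    have carI: "initial_terms ?less ?I \<subseteq> carrier ?R" by (rule initG) auto
    show "genideal ?R (initial_terms ?less ?G) \<subseteq> genideal ?R (initial_terms ?less ?I)"
      by (rule genideal_minimal[OF genideal_ideal[OF carI]])
         (use IG genideal_self[OF carI] in blast)
    have carG: "initial_terms ?less ?G \<subseteq> carrier ?R" by (rule initG[OF G])
    have J: "ideal (genideal ?R (initial_terms ?less ?G)) ?R" by (rule genideal_ideal[OF carG])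
    show "genideal ?R (initial_terms ?less ?I) \<subseteq> genideal ?R (initial_terms ?less ?G)"
    proof (rule genideal_minimal[OF J], rule subsetI)
      fix t :: "('v, 'k) mpoly"
      assume "t \<in> initial_terms ?less ?I"
      then obtain p \<mu> where p: "p \<in> carrier ?R" "pushforward f p = 0" and \<mu>: "\<mu> \<in> Poly_Mapping.keys p"
        and max: "\<forall>\<nu>\<in>Poly_Mapping.keys p. \<nu> \<noteq> \<mu> \<longrightarrow> ?less \<nu> \<mu>"
        and t: "t = Poly_Mapping.single \<mu> (Poly_Mapping.lookup p \<mu>)"
        unfolding initial_terms_def is_initial_term_def by blast
      from other_monomial_in_fibre[OF p(2) \<mu>] obtain \<nu> where
        \<nu>: "\<nu> \<in> Poly_Mapping.keys p" "\<nu> \<noteq> \<mu>" "f \<nu> = f \<mu>" by blast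
      have V: "Poly_Mapping.keys \<mu> \<subseteq> V" "Poly_Mapping.keys \<nu> \<subseteq> V"
        using p(1) \<mu> \<nu>(1) by (auto simp: carrier_mpoly_ring)
      obtain \<alpha> \<beta> \<rho> where *: "(\<alpha>, \<beta>) \<in> B" "\<mu> = \<rho> + \<alpha>"
        using lead[OF V \<nu>(3)[symmetric]] max \<nu> by blast
      have \<rho>: "Poly_Mapping.keys \<rho> \<subseteq> V"
      proof
        fix x assume "x \<in> Poly_Mapping.keys \<rho>"
        then have "x \<in> Poly_Mapping.keys \<mu>" by (simp add: in_keys_iff *(2) lookup_add)
        then show "x \<in> V" using V by blast
      qed
      have "?less \<beta> \<alpha>" using B[OF *(1)] by blast
      moreover from this have "\<beta> \<noteq> \<alpha>" using degrevlex_irrefl by blast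
      ultimately have "is_initial_term ?less (Poly_Mapping.single \<alpha> 1 - Poly_Mapping.single \<beta> 1)
          (Poly_Mapping.single \<alpha> (1 :: 'k))"
        by (rule is_initial_term_binomial)
      then have "Poly_Mapping.single \<alpha> 1 \<in> initial_terms ?less ?G"
        using *(1) unfolding initial_terms_def by blast
      then have "Poly_Mapping.single \<alpha> 1 \<in> genideal ?R (initial_terms ?less ?G)"
        using genideal_self[OF carG] by blast
      from mpoly_ideal_closed(3)[OF J carrier_mpoly_ring_single[OF \<rho>, of "Poly_Mapping.lookup p \<mu>"] this]
      show "t \<in> genideal ?R (initial_terms ?less ?G)"
        by (simp add: t mult_single *(2))
    qed
  qed
  show ?thesis
    unfolding groebner_basis_def using GI gen init by blast
qed

subsection \<open>Minimal dependencies\<close>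

lemma min_index_nonzero:
  fixes a :: "int ^ 's::{finite, linorder}"
  assumes "a \<noteq> 0"
  shows "a $ min_index a \<noteq> 0"
proof -
  have "{i. a $ i \<noteq> 0} \<noteq> {}" using assms by (auto simp: vec_eq_iff)
  then have "min_index a \<in> {i. a $ i \<noteq> 0}" unfolding min_index_def by (intro Min_in) auto
  then show ?thesis by simp
qed

lemma zero_below_min_index:
  fixes a :: "int ^ 's::{finite, linorder}"
  assumes "i < min_index a"
  shows "a $ i = 0"
  using assms Min_le[of "{i. a $ i \<noteq> 0}" i] unfolding min_index_def by fastforce

lemma min_index_eqI:
  fixes a :: "int ^ 's::{finite, linorder}"
  assumes "a $ i \<noteq> 0" "\<And>j. j < i \<Longrightarrow> a $ j = 0"
  shows "min_index a = i"
  unfolding min_index_def using assms by (intro Min_eqI) (auto simp: not_le intro: leI)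

text \<open>
  Read \<open>b\<close> as the multiset \<open>M\<^sub>b\<close> and \<open>p\<close> as a submultiset of it, \<open>p i\<close> being the
  multiplicity of the \<open>i\<close>-th signed column: \<open>p\<close> is favourable if it contains more than
  half of \<open>M\<^sub>b\<close>, or exactly half of it subject to the conditions (a), (b) of the binomials (1).
\<close>

definition favourable :: "int ^ 's::{finite, linorder} \<Rightarrow> ('s \<Rightarrow> int) \<Rightarrow> bool" where
  "favourable b p \<longleftrightarrow> (\<forall>i. 0 \<le> p i \<and> p i \<le> \<bar>b $ i\<bar>) \<and>
     ((\<Sum>i\<in>UNIV. \<bar>b $ i\<bar>) < 2 * (\<Sum>i\<in>UNIV. p i) \<or>
      (\<Sum>i\<in>UNIV. \<bar>b $ i\<bar>) = 2 * (\<Sum>i\<in>UNIV. p i) \<and>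
      (b $ min_index b > 0 \<longrightarrow> p (min_index b) = 0) \<and>
      (b $ min_index b < 0 \<longrightarrow> p (min_index b) < \<bar>b $ min_index b\<bar>))"

lemma sum_abs_pos:
  fixes a :: "int ^ 's::finite"
  assumes "a \<noteq> 0"
  shows "0 < (\<Sum>i\<in>UNIV. \<bar>a $ i\<bar>)"
proof -
  obtain i where "a $ i \<noteq> 0" using assms by (auto simp: vec_eq_iff)
  then show ?thesis by (intro sum_pos2[of _ i]) auto
qed

text \<open>Induction on the size of the multiset of \<open>b\<close>. If \<open>b\<close> is not
  minimal, it splits as \<open>b' + c\<close> without cancellation, and \<open>p\<close> splits
  along with it. The surplus over one half is additive, so one part has a strict majority or both
  are exact halves; in the latter case the condition at the least index passes to one of the
  parts.\<close>

lemma minimal_favourable: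
  fixes A :: "int ^ 's::{finite, linorder} ^ 'm::finite"
  assumes "A *v b = 0" "b \<noteq> 0" "favourable b p"
  shows "\<exists>a q. minimal_dependency A a \<and> favourable a q \<and>
           (\<forall>i. a $ i \<noteq> 0 \<longrightarrow> sgn (a $ i) = sgn (b $ i)) \<and> (\<forall>i. q i \<le> p i)"
  using assms
proof (induction "nat (\<Sum>i\<in>UNIV. \<bar>b $ i\<bar>)" arbitrary: b p rule: less_induct)
  case less
  show ?case
  proof (cases "minimal_dependency A b")
    case True
    then show ?thesis using less.prems(3) by blast
  next
    case False
    then obtain b' where b': "A *v b' = 0" "b' \<noteq> b"
      "\<And>i. sgn (b' $ i) = sgn (b $ i)" "\<And>i. \<bar>b' $ i\<bar> \<le> \<bar>b $ i\<bar>"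
      using less.prems unfolding minimal_dependency_def by blast
    \<comment> \<open>The complementary dependency. Since the signs of \<open>b'\<close> and
      \<open>b\<close> agree, absolute values subtract coordinatewise, and \<open>c\<close> keeps
      the sign of \<open>b\<close> wherever it is nonzero.\<close>
    define c where "c = b - b'"
    have c: "A *v c = 0" "c \<noteq> 0"
      using b' less.prems(1) by (auto simp: c_def matrix_vector_mult_diff_distrib)
    have b'0: "b' \<noteq> 0"
    proof
      assume "b' = 0"
      \<comment> \<open>Equal signs in every coordinate force \<open>b'\<close> to have the full
        support of \<open>b\<close>.\<close>
      then have "\<forall>i. b $ i = 0" using b'(3) by (metis sgn_0_0 sgn_0 zero_index)
      then show False using less.prems(2) by (simp add: vec_eq_iff)
    qed
    have abs_c: "\<bar>c $ i\<bar> = \<bar>b $ i\<bar> - \<bar>b' $ i\<bar>" for i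
      using b'(3)[of i] b'(4)[of i] by (auto simp: c_def sgn_if split: if_splits)
    have sgn_c: "sgn (c $ i) = sgn (b $ i)" if "c $ i \<noteq> 0" for i
      using b'(3)[of i] b'(4)[of i] that by (auto simp: c_def sgn_if split: if_splits)
    have sum_abs: "(\<Sum>i\<in>UNIV. \<bar>b $ i\<bar>) = (\<Sum>i\<in>UNIV. \<bar>b' $ i\<bar>) + (\<Sum>i\<in>UNIV. \<bar>c $ i\<bar>)"
      by (simp add: abs_c sum_subtractf)
    \<comment> \<open>Fill the share of \<open>b'\<close> first and leave the overflow to
      \<open>c\<close>, where it fits by \<open>abs_c\<close>.\<close>
    define p' where "p' = (\<lambda>i. min (p i) \<bar>b' $ i\<bar>)"
    define p'' where "p'' = (\<lambda>i. p i - p' i)"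
    have p: "0 \<le> p i" "p i \<le> \<bar>b $ i\<bar>" for i
      using less.prems(3) by (auto simp: favourable_def)
    have p': "0 \<le> p' i" "p' i \<le> \<bar>b' $ i\<bar>" "p' i \<le> p i" for i
      using p by (auto simp: p'_def)
    have p'': "0 \<le> p'' i" "p'' i \<le> \<bar>c $ i\<bar>" "p'' i \<le> p i" for i
      using p[of i] p'[of i] b'(4)[of i] unfolding p''_def abs_c p'_def by linarith+
    have sum_p: "(\<Sum>i\<in>UNIV. p i) = (\<Sum>i\<in>UNIV. p' i) + (\<Sum>i\<in>UNIV. p'' i)"
      by (simp add: p''_def sum_subtractf)
    have IH_b': ?thesis if "favourable b' p'"
    proof -
      have "nat (\<Sum>i\<in>UNIV. \<bar>b' $ i\<bar>) < nat (\<Sum>i\<in>UNIV. \<bar>b $ i\<bar>)"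
        using sum_abs sum_abs_pos[OF c(2)] sum_abs_pos[OF b'0] by simp
      from less.hyps[OF this b'(1) b'0 that] show ?thesis
        using p'(3) b'(3) by (metis order.trans)
    qed
    have IH_c: ?thesis if "favourable c p''"
    proof -
      have "nat (\<Sum>i\<in>UNIV. \<bar>c $ i\<bar>) < nat (\<Sum>i\<in>UNIV. \<bar>b $ i\<bar>)"
        using sum_abs sum_abs_pos[OF c(2)] sum_abs_pos[OF b'0] by simp
      from less.hyps[OF this c that] obtain a q where
        *: "minimal_dependency A a" "favourable a q" "\<forall>i. a $ i \<noteq> 0 \<longrightarrow> sgn (a $ i) = sgn (c $ i)"
          "\<forall>i. q i \<le> p'' i" by blast
      have "\<forall>i. a $ i \<noteq> 0 \<longrightarrow> sgn (a $ i) = sgn (b $ i)"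
        using *(3) sgn_c by (metis sgn_0_0)
      with * show ?thesis using p''(3) by (meson order.trans)
    qed
    consider "(\<Sum>i\<in>UNIV. \<bar>b' $ i\<bar>) < 2 * (\<Sum>i\<in>UNIV. p' i)"
      | "(\<Sum>i\<in>UNIV. \<bar>c $ i\<bar>) < 2 * (\<Sum>i\<in>UNIV. p'' i)"
      | "(\<Sum>i\<in>UNIV. \<bar>b' $ i\<bar>) = 2 * (\<Sum>i\<in>UNIV. p' i)" "(\<Sum>i\<in>UNIV. \<bar>c $ i\<bar>) = 2 * (\<Sum>i\<in>UNIV. p'' i)"
        "(\<Sum>i\<in>UNIV. \<bar>b $ i\<bar>) = 2 * (\<Sum>i\<in>UNIV. p i)"
      using less.prems(3) sum_abs sum_p unfolding favourable_def by linarith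
    then show ?thesis
    proof cases
      case 1
      then show ?thesis using p' by (intro IH_b') (auto simp: favourable_def)
    next
      case 2
      then show ?thesis using p'' by (intro IH_c) (auto simp: favourable_def)
    next
      case 3
      let ?i = "min_index b"
      have bi: "b $ ?i \<noteq> 0" by (rule min_index_nonzero[OF less.prems(2)])
      have zero_b': "b' $ j = 0" if "b $ j = 0" for j using b'(4)[of j] that by simp
      have zero_c: "c $ j = 0" if "b $ j = 0" for j using that zero_b'[OF that] by (simp add: c_def)
      have b'i: "b' $ ?i \<noteq> 0" using b'(3)[of ?i] bi by (metis sgn_0_0)
      have min_b': "min_index b' = ?i"
        by (rule min_index_eqI[OF b'i]) (simp add: zero_b' zero_below_min_index)
      have cond: "b $ ?i > 0 \<longrightarrow> p ?i = 0" "b $ ?i < 0 \<longrightarrow> p ?i < \<bar>b $ ?i\<bar>"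
        using less.prems(3) 3(3) by (auto simp: favourable_def)
      show ?thesis
      \<comment> \<open>At the least index \<open>b'\<close> inherits (a) and (b), except when
        \<open>p'\<close> exhausts its negative entry. Then the slack of \<open>p\<close> lies in
        \<open>c\<close>, which forces \<open>c\<close> to be nonzero at that index and makes it the
        favourable part.\<close>
      proof (cases "b $ ?i < 0 \<and> p' ?i = \<bar>b' $ ?i\<bar>")
        case False
        have "favourable b' p'"
          unfolding favourable_def min_b'
        proof (intro conjI allI disjI2 impI)
          show "p' ?i = 0" if "0 < b' $ ?i"
          proof -
            have "b $ ?i > 0" using b'(3)[of ?i] that by (metis sgn_greater)
            then show ?thesis using cond(1) p'[of ?i] by simp
          qed
          show "p' ?i < \<bar>b' $ ?i\<bar>" if "b' $ ?i < 0"
          proof -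
            have "b $ ?i < 0" using b'(3)[of ?i] that by (metis sgn_less)
            then show ?thesis using False p'[of ?i] by simp
          qed
        qed (use p' 3(1) in auto)
        then show ?thesis by (rule IH_b')
      next
        case True
        then have less_c: "p'' ?i < \<bar>c $ ?i\<bar>" using cond(2) by (simp add: abs_c p''_def)
        then have ci: "c $ ?i \<noteq> 0" using p''(1)[of ?i] by auto
        have min_c: "min_index c = ?i"
          by (rule min_index_eqI[OF ci]) (simp add: zero_c zero_below_min_index)
        have "c $ ?i < 0" using sgn_c[OF ci] True by (metis sgn_less)
        then have "favourable c p''"
          unfolding favourable_def min_c using p'' 3(2) less_c by auto
        then show ?thesis by (rule IH_c)
      qed
    qed
  qed
qed

subsection \<open>Monomials as multisets and the toric grading\<close>

definition exponent :: "'v multiset \<Rightarrow> ('v \<Rightarrow>\<^sub>0 nat)" where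
  "exponent M = (\<Sum>x\<in>#M. Poly_Mapping.single x 1)"

lemma exponent_simps [simp]:
  "exponent {#} = 0" "exponent (add_mset x M) = Poly_Mapping.single x 1 + exponent M"
  by (simp_all add: exponent_def)

lemma lookup_exponent [simp]: "Poly_Mapping.lookup (exponent M) x = count M x"
  by (induction M) (auto simp: lookup_add lookup_single when_def)

lemma keys_exponent [simp]: "Poly_Mapping.keys (exponent M) = set_mset M"
  by (auto simp: in_keys_iff)

lemma mset_monomial_eq_single: "mset_monomial M = Poly_Mapping.single (exponent M) 1"
  by (induction M) (auto simp: mset_monomial_def Var_def mult_single)

lemma Var_mult_mset_monomial: "Var x * mset_monomial M = mset_monomial (add_mset x M)"
  by (simp add: mset_monomial_def)

text \<open>The exponent of the image of a monomial under the toric map; the second component is the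
  power of \<open>s\<close>, that is, the total degree.\<close>

definition toric_degree :: "(int ^ 'm \<Rightarrow>\<^sub>0 nat) \<Rightarrow> (int ^ 'm) \<times> nat" where
  "toric_degree \<mu> = (\<Sum>\<alpha>\<in>Poly_Mapping.keys \<mu>.
     (int (Poly_Mapping.lookup \<mu> \<alpha>) *s \<alpha>, Poly_Mapping.lookup \<mu> \<alpha>))"

lemma toric_degree_add: "toric_degree (\<mu> + \<nu>) = toric_degree \<mu> + toric_degree \<nu>"
  unfolding toric_degree_def
  by (rule setsum_keys_plus_distrib) (simp_all add: vector_sadd_rdistrib prod_eq_iff)

lemma toric_degree_exponent: "toric_degree (exponent M) = (sum_mset M, size M)"
proof (induction M)
  case empty
  show ?case by (simp add: toric_degree_def prod_eq_iff)
next
  case (add x M)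
  then show ?case by (simp add: toric_degree_add) (simp add: toric_degree_def)
qed

lemma toric_degree_superset:
  assumes "finite V" "Poly_Mapping.keys \<mu> \<subseteq> V"
  shows "toric_degree \<mu> = (\<Sum>\<alpha>\<in>V. int (Poly_Mapping.lookup \<mu> \<alpha>) *s \<alpha>, \<Sum>\<alpha>\<in>V. Poly_Mapping.lookup \<mu> \<alpha>)"
proof -
  have "toric_degree \<mu> = (\<Sum>\<alpha>\<in>V. (int (Poly_Mapping.lookup \<mu> \<alpha>) *s \<alpha>, Poly_Mapping.lookup \<mu> \<alpha>))"
    unfolding toric_degree_def using assms
    by (intro sum.mono_neutral_left) (auto simp: in_keys_iff simp add: prod_eq_iff)
  then show ?thesis by (simp add: prod_eq_iff fst_sum snd_sum)
qed

lemma single_lattice_power: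
  "Poly_Mapping.single (\<alpha> :: int ^ 'm, 1 :: nat) (1 :: 'k::comm_ring_1) ^ n =
     Poly_Mapping.single (int n *s \<alpha>, n) 1"
proof (induction n)
  case 0
  have "(0 :: int ^ 'm, 0 :: nat) = 0" by (simp add: prod_eq_iff)
  then show ?case by (simp flip: single_one)
next
  case (Suc n)
  then show ?case by (simp add: mult_single vector_sadd_rdistrib)
qed

lemma prod_single:
  "(\<Prod>x\<in>S. Poly_Mapping.single (h x) (1 :: 'k::comm_ring_1)) = Poly_Mapping.single (\<Sum>x\<in>S. h x) 1"
  by (induction S rule: infinite_finite_induct) (auto simp: mult_single)

text \<open>Monomials go to monomials with coefficient one, so the toric map only relabels exponents
  and its kernel falls under the general criterion.\<close>

lemma toric_map_eq_pushforward:
  fixes p :: "(int ^ 'm::finite, 'k::comm_ring_1) mpoly"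
  shows "toric_map p = pushforward toric_degree p"
  by (simp only: toric_map_def pushforward_def single_lattice_power prod_single mult_single
      toric_degree_def add_0 mult_1_right)


subsection \<open>Lattice points of a saturated matrix\<close>

lemma column_sym_matrix [simp]:
  "column (Inl i) (sym_matrix A) = column i A" "column (Inr i) (sym_matrix A) = - column i A"
  by (simp_all add: column_def sym_matrix_def vec_eq_iff)

lemma real_vec_simps [simp]: "real_vec 0 = 0" "real_vec (- x) = - real_vec x"
  by (simp_all add: real_vec_def vec_eq_iff)

lemma column_in_lattice_points: "column j (sym_matrix A) \<in> lattice_points (polytope_of A)"
  by (auto simp: lattice_points_def polytope_of_def columns_def intro!: hull_inc)

text \<open>The origin is the midpoint of a column and its negative.\<close>

lemma zero_in_lattice_points:
  fixes A :: "int ^ 's::finite ^ 'm::finite"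
  shows "0 \<in> lattice_points (polytope_of A)"
proof -
  let ?F = "real_vec (column undefined A)"
  have "?F \<in> polytope_of A" "- ?F \<in> polytope_of A"
    using column_in_lattice_points[of "Inl undefined" A] column_in_lattice_points[of "Inr undefined" A]
    by (simp_all add: lattice_points_def)
  moreover have "convex (polytope_of A)" by (simp add: polytope_of_def)
  ultimately have "(1/2) *\<^sub>R ?F + (1/2) *\<^sub>R (- ?F) \<in> polytope_of A"
    by (intro convexD) auto
  then show ?thesis by (simp add: lattice_points_def)
qed

text \<open>A zero column would coincide with its negative and with the origin. Excluding it,
  together with saturation, makes the origin and all signed columns pairwise distinct, hence
  distinct variables.\<close>

locale saturated_matrix =
  fixes A :: "int ^ 's::{finite, linorder} ^ 'm::finite"
  assumes saturated: "saturated A" and nonzero_columns: "\<And>i. column i A \<noteq> 0"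
begin

abbreviation "V \<equiv> lattice_points (polytope_of A)"

text \<open>Each column of \<open>[A | -A]\<close> is a nonzero lattice point of the polytope, and
  saturation allows it one index only.\<close>

lemma column_sym_matrix_inj:
  assumes "column j (sym_matrix A) = column j' (sym_matrix A)"
  shows "j = j'"
proof -
  have "column j (sym_matrix A) \<noteq> 0" using nonzero_columns by (cases j) auto
  then show ?thesis
    using saturated column_in_lattice_points[of j A] assms unfolding saturated_def by metis
qed

lemma column_eq_iff [simp]:
  "column i A = column j A \<longleftrightarrow> i = j"
  "column i A \<noteq> - column j A" "- column i A \<noteq> column j A"
  using column_sym_matrix_inj[of "Inl i" "Inl j"] column_sym_matrix_inj[of "Inl i" "Inr j"]
    column_sym_matrix_inj[of "Inr i" "Inl j"] by auto

lemma lattice_points_eq: "V = insert 0 (range (\<lambda>i. column i A) \<union> range (\<lambda>i. - column i A))"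
proof (intro equalityI subsetI)
  fix \<alpha> assume \<alpha>: "\<alpha> \<in> V"
  show "\<alpha> \<in> insert 0 (range (\<lambda>i. column i A) \<union> range (\<lambda>i. - column i A))"
  proof (cases "\<alpha> = 0")
    case False
    then obtain j where "column j (sym_matrix A) = \<alpha>" using saturated \<alpha> unfolding saturated_def by metis
    then show ?thesis by (cases j) auto
  qed simp
next
  fix \<alpha> assume "\<alpha> \<in> insert 0 (range (\<lambda>i. column i A) \<union> range (\<lambda>i. - column i A))"
  then show "\<alpha> \<in> V"
    using zero_in_lattice_points[of A] column_in_lattice_points[of "Inl _" A]
      column_in_lattice_points[of "Inr _" A] by auto
qed

lemma finite_lattice_points [simp]: "finite V"
  by (simp add: lattice_points_eq)

lemma column_mem [simp]: "column i A \<in> V" "- column i A \<in> V" "0 \<in> V"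
  by (auto simp: lattice_points_eq)

lemma set_variables: "set (variables A) = V"
  by (auto simp: variables_def lattice_points_eq)

lemma distinct_variables: "distinct (variables A)"
proof -
  have "distinct (concat (map (\<lambda>j. [column j A, - column j A]) xs))" if "distinct xs" for xs
    using that nonzero_columns by (induction xs) auto
  then show ?thesis
    using nonzero_columns by (auto simp: variables_def dest: sym)
qed

lemma sum_lattice_points:
  fixes g :: "int ^ 'm \<Rightarrow> 'b::comm_monoid_add"
  shows "(\<Sum>\<alpha>\<in>V. g \<alpha>) = g 0 + (\<Sum>i\<in>UNIV. g (column i A) + g (- column i A))"
proof -
  have "(\<Sum>\<alpha>\<in>V. g \<alpha>) = g 0 + (\<Sum>\<alpha>\<in>range (\<lambda>i. column i A) \<union> range (\<lambda>i. - column i A). g \<alpha>)"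
    unfolding lattice_points_eq using nonzero_columns
    by (subst sum.insert) (auto dest: sym)
  also have "(\<Sum>\<alpha>\<in>range (\<lambda>i. column i A) \<union> range (\<lambda>i. - column i A). g \<alpha>) =
      (\<Sum>\<alpha>\<in>range (\<lambda>i. column i A). g \<alpha>) + (\<Sum>\<alpha>\<in>range (\<lambda>i. - column i A). g \<alpha>)"
    by (intro sum.union_disjoint) auto
  also have "\<dots> = (\<Sum>i\<in>UNIV. g (column i A) + g (- column i A))"
    by (simp add: sum.reindex inj_on_def sum.distrib)
  finally show ?thesis .
qed

section \<open>Comparing monomials along the list of variables\<close>

lemma degree_variables:
  "(\<Sum>y\<leftarrow>variables A. Poly_Mapping.lookup \<mu> y) = (\<Sum>\<alpha>\<in>V. Poly_Mapping.lookup \<mu> \<alpha>)"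
  by (simp add: sum_list_distinct_conv_sum_set distinct_variables set_variables)

lemma variables_split:
  "\<exists>zs ws. variables A = zs @ column i A # - column i A # ws \<and>
     set zs = insert 0 (\<Union>j\<in>{..<i}. {column j A, - column j A})"
proof -
  have "i \<in> set (sorted_list_of_set (UNIV :: 's set))" by simp
  then obtain xs ys where s: "sorted_list_of_set (UNIV :: 's set) = xs @ i # ys"
    by (meson split_list)
  have "sorted (xs @ i # ys)" "distinct (xs @ i # ys)" "set (xs @ i # ys) = UNIV"
    by (simp_all flip: s)
  then have "set xs = {..<i}"
    by (fastforce simp: sorted_append)
  then have "set (0 # concat (map (\<lambda>j. [column j A, - column j A]) xs)) =
      insert 0 (\<Union>j\<in>{..<i}. {column j A, - column j A})"
    by auto
  then show ?thesis
    by (intro exI[of _ "0 # concat (map (\<lambda>j. [column j A, - column j A]) xs)"]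
        exI[of _ "concat (map (\<lambda>j. [column j A, - column j A]) ys)"]) (simp add: variables_def s)
qed

text \<open>The origin comes first in the list, so its exponent decides before any other.\<close>

lemma degrevlex_origin:
  assumes "(\<Sum>\<alpha>\<in>V. Poly_Mapping.lookup \<mu> \<alpha>) = (\<Sum>\<alpha>\<in>V. Poly_Mapping.lookup \<nu> \<alpha>)"
    and "Poly_Mapping.lookup \<mu> 0 > Poly_Mapping.lookup \<nu> 0"
  shows "degrevlex_less (variables A) \<mu> \<nu>"
proof (rule degrevlex_first_difference)
  show "variables A = [] @ 0 # tl (variables A)" by (simp add: variables_def)
qed (use assms in \<open>simp_all add: degree_variables\<close>)

text \<open>The two alternatives reflect that \<open>-F_i\<close> directly follows
  \<open>F_i\<close> in the list and decides only on a tie there.\<close>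

lemma degrevlex_column:
  assumes deg: "(\<Sum>\<alpha>\<in>V. Poly_Mapping.lookup \<mu> \<alpha>) = (\<Sum>\<alpha>\<in>V. Poly_Mapping.lookup \<nu> \<alpha>)"
    and zero: "Poly_Mapping.lookup \<mu> 0 = Poly_Mapping.lookup \<nu> 0"
    and below: "\<And>j. j < i \<Longrightarrow> Poly_Mapping.lookup \<mu> (column j A) = Poly_Mapping.lookup \<nu> (column j A)"
      "\<And>j. j < i \<Longrightarrow> Poly_Mapping.lookup \<mu> (- column j A) = Poly_Mapping.lookup \<nu> (- column j A)"
    and diff: "Poly_Mapping.lookup \<mu> (column i A) > Poly_Mapping.lookup \<nu> (column i A) \<or>
      Poly_Mapping.lookup \<mu> (column i A) = Poly_Mapping.lookup \<nu> (column i A) \<and>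
      Poly_Mapping.lookup \<mu> (- column i A) > Poly_Mapping.lookup \<nu> (- column i A)"
  shows "degrevlex_less (variables A) \<mu> \<nu>"
proof -
  obtain zs ws where s: "variables A = zs @ column i A # - column i A # ws"
    "set zs = insert 0 (\<Union>j\<in>{..<i}. {column j A, - column j A})"
    using variables_split[of i] by metis
  have deg': "(\<Sum>y\<leftarrow>variables A. Poly_Mapping.lookup \<mu> y) = (\<Sum>y\<leftarrow>variables A. Poly_Mapping.lookup \<nu> y)"
    using deg by (simp add: degree_variables)
  have zs: "Poly_Mapping.lookup \<mu> x = Poly_Mapping.lookup \<nu> x" if "x \<in> set zs" for x
    using that zero below s(2) by auto
  from diff show ?thesis
  proof
    assume "Poly_Mapping.lookup \<mu> (column i A) > Poly_Mapping.lookup \<nu> (column i A)"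
    with degrevlex_first_difference[OF s(1) deg'] zs show ?thesis by blast
  next
    assume *: "Poly_Mapping.lookup \<mu> (column i A) = Poly_Mapping.lookup \<nu> (column i A) \<and>
      Poly_Mapping.lookup \<mu> (- column i A) > Poly_Mapping.lookup \<nu> (- column i A)"
    have "variables A = (zs @ [column i A]) @ - column i A # ws" using s(1) by simp
    from degrevlex_first_difference[OF this deg'] * zs show ?thesis by auto
  qed
qed

end

subsection \<open>The binomials of a dependency\<close>

text \<open>Turns a multiplicity function as used in \<open>favourable\<close> into the submultiset
  that it encodes; \<open>q\<close> itself carries no signs.\<close>

definition signed_mset :: "int ^ 's::finite ^ 'm \<Rightarrow> int ^ 's \<Rightarrow> ('s \<Rightarrow> int) \<Rightarrow> (int ^ 'm) multiset" where
  "signed_mset A a q = (\<Sum>l\<in>UNIV. replicate_mset (nat (q l)) (sgn (a $ l) *s column l A))"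

lemma dep_mset_eq_signed_mset: "dep_mset A a = signed_mset A a (\<lambda>l. \<bar>a $ l\<bar>)"
  by (simp add: dep_mset_def signed_mset_def)

lemma size_signed_mset:
  assumes "\<And>l. 0 \<le> q l"
  shows "int (size (signed_mset A a q)) = (\<Sum>l\<in>UNIV. q l)"
proof -
  have "size (\<Sum>l\<in>S. f l) = (\<Sum>l\<in>S. size (f l))" for S and f :: "'s \<Rightarrow> (int ^ 'm) multiset"
    by (induction S rule: infinite_finite_induct) auto
  then show ?thesis using assms by (simp add: signed_mset_def)
qed

lemma sum_mset_replicate_vec: "sum_mset (replicate_mset n x) = int n *s (x :: int ^ 'm::finite)"
  by (induction n) (auto simp: vector_sadd_rdistrib)

text \<open>Sign times absolute value restores each entry of \<open>a\<close>, so \<open>a\<close>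
  lies in the kernel exactly when its signed columns sum to zero.\<close>

lemma sum_dep_mset:
  fixes A :: "int ^ 's::finite ^ 'm::finite"
  shows "sum_mset (dep_mset A a) = A *v a"
proof -
  have "sum_mset (\<Sum>l\<in>S. f l) = (\<Sum>l\<in>S. sum_mset (f l))" for S and f :: "'s \<Rightarrow> (int ^ 'm) multiset"
    by (induction S rule: infinite_finite_induct) auto
  moreover have "sum_mset (replicate_mset (nat \<bar>a $ l\<bar>) (sgn (a $ l) *s column l A)) = a $ l *s column l A" for l
    unfolding sum_mset_replicate_vec by (simp add: vector_smult_assoc abs_mult_sgn)
  ultimately show ?thesis
    by (simp only: dep_mset_def matrix_mult_sum)
qed

lemma count_image_uminus: "count (image_mset uminus M) x = count M (- x :: 'a::group_add)"
  by (induction M) (auto simp: minus_equation_iff[of x])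

lemma sum_image_uminus: "sum_mset (image_mset uminus M) = - sum_mset (M :: 'a::ab_group_add multiset)"
  by (induction M) auto

lemma exists_submset_of_size:
  assumes "k \<le> size U"
  shows "\<exists>M. M \<subseteq># U \<and> size M = k"
proof -
  obtain xs where xs: "U = mset xs" using ex_mset by metis
  have "mset (take k xs) \<subseteq># mset (take k xs) + mset (drop k xs)" by simp
  then have "mset (take k xs) \<subseteq># U" by (simp only: xs flip: mset_append) simp
  then show ?thesis using assms xs by (intro exI[of _ "mset (take k xs)"]) simp
qed

context saturated_matrix
begin

text \<open>Signed columns are pairwise distinct, so only the summand with the same index can
  contribute, and only if its sign fits.\<close>

lemma count_signed_mset:
  assumes "\<And>l. 0 \<le> q l" "\<And>l. q l \<le> \<bar>a $ l\<bar>"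
  shows "count (signed_mset A a q) (column i A) = (if a $ i > 0 then nat (q i) else 0)"
    and "count (signed_mset A a q) (- column i A) = (if a $ i < 0 then nat (q i) else 0)"
    and "count (signed_mset A a q) 0 = 0"
proof -
  \<comment> \<open>Where \<open>a\<close> vanishes, the signed column degenerates to the origin;
    multiplicity zero keeps it out.\<close>
  have zero: "q l = 0" if "a $ l = 0" for l using assms[of l] that by simp
  have sgn_smult: "sgn (a $ l) *s column l A =
      (if a $ l > 0 then column l A else if a $ l < 0 then - column l A else 0)" for l
    by (simp add: sgn_if flip: vector_sneg_minus1)
  have "count (replicate_mset (nat (q l)) (sgn (a $ l) *s column l A)) (column i A) =
      (if l = i then if a $ i > 0 then nat (q i) else 0 else 0)" for l
    using zero[of l] nonzero_columns by (auto simp: sgn_smult)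
  then show "count (signed_mset A a q) (column i A) = (if a $ i > 0 then nat (q i) else 0)"
    by (simp add: signed_mset_def count_sum)
  have "count (replicate_mset (nat (q l)) (sgn (a $ l) *s column l A)) (- column i A) =
      (if l = i then if a $ i < 0 then nat (q i) else 0 else 0)" for l
    using zero[of l] nonzero_columns by (auto simp: sgn_smult)
  then show "count (signed_mset A a q) (- column i A) = (if a $ i < 0 then nat (q i) else 0)"
    by (simp add: signed_mset_def count_sum)
  have "count (replicate_mset (nat (q l)) (sgn (a $ l) *s column l A)) 0 = 0" for l
    using zero[of l] nonzero_columns by (auto simp: sgn_smult)
  then show "count (signed_mset A a q) 0 = 0"
    by (simp add: signed_mset_def count_sum)
qed

lemmas count_dep_mset =
  count_signed_mset[where q = "\<lambda>l. \<bar>a $ l\<bar>" and a = a for a, simplified, folded dep_mset_eq_signed_mset]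

lemma signed_mset_subset_dep:
  assumes "\<And>l. q l \<le> \<bar>a $ l\<bar>"
  shows "signed_mset A a q \<subseteq># dep_mset A a"
  unfolding dep_mset_eq_signed_mset signed_mset_def
  by (rule mset_subset_eqI) (auto simp: count_sum assms nat_mono intro!: sum_mono)

lemma signed_column_cases: "\<exists>i. x = column i A \<or> x = - column i A" if "x \<in> V" "x \<noteq> 0"
  using that by (auto simp: lattice_points_eq)

lemma set_dep_mset: "set_mset (dep_mset A a) \<subseteq> V"
proof -
  have "set_mset (\<Sum>l\<in>S. replicate_mset (nat \<bar>a $ l\<bar>) (sgn (a $ l) *s column l A)) \<subseteq> V" for S
    by (induction S rule: infinite_finite_induct) (auto simp: sgn_if simp flip: vector_sneg_minus1 split: if_splits)
  then show ?thesis by (simp add: dep_mset_def)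
qed

lemma uminus_lattice_point: "x \<in> V \<Longrightarrow> - x \<in> V"
  by (auto simp: lattice_points_eq)

lemma sum_count: "set_mset M \<subseteq> V \<Longrightarrow> (\<Sum>\<alpha>\<in>V. count M \<alpha>) = size M"
  using toric_degree_superset[of V "exponent M"] by (simp add: toric_degree_exponent)

text \<open>The whole multiset sums to zero, so a part and its negated complement have equal sums.
  Up to degree, this puts the binomials into the toric ideal.\<close>

lemma complement_facts:
  assumes "A *v a = 0" "M \<subseteq># dep_mset A a"
  shows "sum_mset (image_mset uminus (dep_mset A a - M)) = sum_mset M"
    and "set_mset M \<subseteq> V" "set_mset (image_mset uminus (dep_mset A a - M)) \<subseteq> V"
    and "count M 0 = 0"
proof -
  have "sum_mset M + sum_mset (dep_mset A a - M) = 0"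
    using sum_dep_mset[of A a] assms by (simp flip: sum_mset.union)
  then show "sum_mset (image_mset uminus (dep_mset A a - M)) = sum_mset M"
    by (simp add: sum_image_uminus eq_neg_iff_add_eq_0[symmetric])
  show "set_mset M \<subseteq> V" using set_mset_mono[OF assms(2)] set_dep_mset by blast
  show "set_mset (image_mset uminus (dep_mset A a - M)) \<subseteq> V"
    using set_dep_mset[of a] by (auto dest!: in_diffD intro!: uminus_lattice_point)
  show "count M 0 = 0" using mset_subset_eq_count[OF assms(2), of 0] count_dep_mset(3) by simp
qed

text \<open>The sign conditions (a), (b) say that the least signed column whose multiplicities
  differ occurs in the second monomial more often than in the first.\<close>

lemma degrevlex_binomial1:
  assumes M: "M \<subseteq># dep_mset A a" and a: "a \<noteq> 0" "A *v a = 0"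
    and size: "size (dep_mset A a) = 2 * k" "size M = k"
    and pos: "a $ min_index a > 0 \<longrightarrow> column (min_index a) A \<notin># M"
    and neg: "a $ min_index a < 0 \<longrightarrow>
      \<not> replicate_mset (nat \<bar>a $ min_index a\<bar>) (- column (min_index a) A) \<subseteq># M"
  shows "degrevlex_less (variables A) (exponent (image_mset uminus (dep_mset A a - M))) (exponent M)"
proof (rule degrevlex_column[of _ _ "min_index a"])
  let ?D = "dep_mset A a" and ?i = "min_index a"
  let ?N = "image_mset uminus (?D - M)"
  have cM: "count M x \<le> count ?D x" for x using M by (rule mset_subset_eq_count)
  have cN: "count ?N x = count ?D (- x) - count M (- x)" for x by (simp add: count_image_uminus)
  show "(\<Sum>\<alpha>\<in>V. Poly_Mapping.lookup (exponent ?N) \<alpha>) = (\<Sum>\<alpha>\<in>V. Poly_Mapping.lookup (exponent M) \<alpha>)"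
    using complement_facts[OF a(2) M] size size_Diff_submset[OF M] by (simp add: sum_count)
  show "Poly_Mapping.lookup (exponent ?N) 0 = Poly_Mapping.lookup (exponent M) 0"
    using cM[of 0] by (simp add: cN count_dep_mset)
  show "Poly_Mapping.lookup (exponent ?N) (column j A) = Poly_Mapping.lookup (exponent M) (column j A)"
    "Poly_Mapping.lookup (exponent ?N) (- column j A) = Poly_Mapping.lookup (exponent M) (- column j A)"
    if "j < ?i" for j
    using cM[of "column j A"] cM[of "- column j A"] zero_below_min_index[OF that]
    by (simp_all add: cN count_dep_mset)
  show "Poly_Mapping.lookup (exponent M) (column ?i A) < Poly_Mapping.lookup (exponent ?N) (column ?i A) \<or>
      Poly_Mapping.lookup (exponent ?N) (column ?i A) = Poly_Mapping.lookup (exponent M) (column ?i A) \<and>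
      Poly_Mapping.lookup (exponent M) (- column ?i A) < Poly_Mapping.lookup (exponent ?N) (- column ?i A)"
  \<comment> \<open>For a positive entry, \<open>F\<close> occurs in neither monomial and the copies
    of \<open>-F\<close> in the second one decide. For a negative entry, some \<open>-F\<close> is
    left out of \<open>M\<close> and turns into \<open>F\<close> in the second monomial, which
    decides.\<close>
  proof (cases "a $ ?i > 0")
    case True
    then have "count M (column ?i A) = 0" using pos by (simp add: count_eq_zero_iff)
    then show ?thesis
      using True cM[of "- column ?i A"] by (simp add: cN count_dep_mset)
  next
    case False
    then have "a $ ?i < 0" using min_index_nonzero[OF a(1)] by simp
    then show ?thesis
      using neg cM[of "column ?i A"]
      by (simp add: cN count_dep_mset not_le flip: count_le_replicate_mset_subset_eq)
  qed
qed

text \<open>Negated complements preserve the lattice sum, and powers of \<open>z\<close> even out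
  the degrees. In types (2) to (4) \<open>z\<close> divides only the second monomial, making it the
  smaller one; type (1) relies on its sign conditions.\<close>

lemma binomials_homogeneous:
  assumes "(x, y) \<in> (binomials A :: ((int ^ 'm, 'k::comm_ring_1) mpoly \<times> (int ^ 'm, 'k) mpoly) set)"
  shows "\<exists>\<mu> \<nu>. x = Poly_Mapping.single \<mu> 1 \<and> y = Poly_Mapping.single \<nu> 1 \<and>
    Poly_Mapping.keys \<mu> \<subseteq> V \<and> Poly_Mapping.keys \<nu> \<subseteq> V \<and>
    toric_degree \<mu> = toric_degree \<nu> \<and> degrevlex_less (variables A) \<nu> \<mu>"
proof -
  have *: ?thesis if "x = mset_monomial M" "y = mset_monomial N" "set_mset M \<subseteq> V" "set_mset N \<subseteq> V"
    "sum_mset M = sum_mset N" "size M = size N" "degrevlex_less (variables A) (exponent N) (exponent M)" for M N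
    using that by (intro exI[of _ "exponent M"] exI[of _ "exponent N"])
      (simp add: mset_monomial_eq_single toric_degree_exponent)
  have origin: "degrevlex_less (variables A) (exponent N) (exponent M)"
    if "set_mset M \<subseteq> V" "set_mset N \<subseteq> V" "size M = size N" "count M 0 = 0" "0 \<in># N" for M N
    using that by (intro degrevlex_origin) (simp_all add: sum_count)
  consider "(x, y) \<in> binomials1 A" | "(x, y) \<in> binomials2 A" | "(x, y) \<in> binomials3 A"
    | "(x, y) \<in> binomials4 A"
    using assms unfolding binomials_def by blast
  then show ?thesis
  proof cases
    case 1
    then obtain a k M where xy: "x = mset_monomial M" "y = mset_monomial (image_mset uminus (dep_mset A a - M))"
      and a: "minimal_dependency A a" and M: "M \<subseteq># dep_mset A a"
      and size: "size (dep_mset A a) = 2 * k" "size M = k"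
      and cond: "a $ min_index a > 0 \<longrightarrow> column (min_index a) A \<notin># M"
        "a $ min_index a < 0 \<longrightarrow>
           \<not> replicate_mset (nat \<bar>a $ min_index a\<bar>) (- column (min_index a) A) \<subseteq># M"
      unfolding binomials1_def by blast
    have a0: "a \<noteq> 0" "A *v a = 0" using a by (auto simp: minimal_dependency_def)
    show ?thesis
      by (rule *[OF xy])
         (use complement_facts[OF a0(2) M] size size_Diff_submset[OF M]
            degrevlex_binomial1[OF M a0 size cond] in auto)
  next
    case 2
    then obtain a k M where xy: "x = mset_monomial M"
        "y = Var 0 * mset_monomial (image_mset uminus (dep_mset A a - M))"
      and a: "minimal_dependency A a" and M: "M \<subseteq># dep_mset A a"
      and size: "size (dep_mset A a) = 2 * k + 1" "size M = k + 1"
      unfolding binomials2_def by blast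
    let ?N = "add_mset 0 (image_mset uminus (dep_mset A a - M))"
    have y: "y = mset_monomial ?N" using xy(2) by (simp add: Var_mult_mset_monomial)
    have a0: "A *v a = 0" using a by (auto simp: minimal_dependency_def)
    note f = complement_facts[OF a0 M]
    have N: "set_mset ?N \<subseteq> V" using f(3) by simp
    have sz: "size M = size ?N" using size size_Diff_submset[OF M] by simp
    show ?thesis
      by (rule *[OF xy(1) y f(2) N _ sz origin[OF f(2) N sz f(4)]]) (use f(1) in simp_all)
  next
    case 3
    then obtain a k M where xy: "x = mset_monomial M"
        "y = Var 0 ^ 2 * mset_monomial (image_mset uminus (dep_mset A a - M))"
      and a: "minimal_dependency A a" and M: "M \<subseteq># dep_mset A a"
      and size: "size (dep_mset A a) = 2 * k" "size M = k + 1"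
      unfolding binomials3_def by blast
    let ?N = "add_mset 0 (add_mset 0 (image_mset uminus (dep_mset A a - M)))"
    have y: "y = mset_monomial ?N"
      using xy(2) by (simp add: power2_eq_square mult.assoc Var_mult_mset_monomial)
    have a0: "A *v a = 0" using a by (auto simp: minimal_dependency_def)
    note f = complement_facts[OF a0 M]
    have N: "set_mset ?N \<subseteq> V" using f(3) by simp
    \<comment> \<open>The inclusion gives \<open>k + 1 \<le> 2 * k\<close>, so the complement has
      exactly \<open>k - 1\<close> elements, and two copies of the origin restore
      \<open>k + 1\<close>.\<close>
    have sz: "size M = size ?N"
      using size size_Diff_submset[OF M] size_mset_mono[OF M] by simp
    show ?thesis
      by (rule *[OF xy(1) y f(2) N _ sz origin[OF f(2) N sz f(4)]]) (use f(1) in simp_all)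
  next
    case 4
    then obtain i where xy: "x = Var (column i A) * Var (- column i A)" "y = Var 0 ^ 2"
      unfolding binomials4_def by blast
    let ?M = "{#column i A, - column i A#}" and ?N = "{#0, 0 :: int ^ 'm#}"
    have x: "x = mset_monomial ?M" "y = mset_monomial ?N"
      using xy by (simp_all add: mset_monomial_def power2_eq_square)
    have MN: "set_mset ?M \<subseteq> V" "set_mset ?N \<subseteq> V" "size ?M = size ?N" "count ?M 0 = 0" "0 \<in># ?N"
      using nonzero_columns[of i] by auto
    show ?thesis
      by (rule *[OF x MN(1,2) _ MN(3) origin[OF MN]]) simp
  qed
qed

text \<open>Parity and surplus select the type. Odd size gives (2). For even size, exactly half
  gives (1). With more than half, two available copies of the positive least column give (3);
  otherwise discarding one copy of the least signed column leaves room for a half that satisfies (a)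
  and (b).\<close>

lemma minimal_favourable_binomial:
  assumes a: "minimal_dependency A a" and q: "favourable a q"
  shows "\<exists>M y. (mset_monomial M, y) \<in>
      (binomials A :: ((int ^ 'm, 'k::comm_ring_1) mpoly \<times> (int ^ 'm, 'k) mpoly) set) \<and>
      M \<subseteq># signed_mset A a q"
proof -
  let ?D = "dep_mset A a" and ?U = "signed_mset A a q" and ?i = "min_index a"
  let ?F = "column ?i A"
  have q': "0 \<le> q l" "q l \<le> \<bar>a $ l\<bar>" for l using q by (auto simp: favourable_def)
  have UD: "?U \<subseteq># ?D" using q' by (intro signed_mset_subset_dep)
  have a0: "a \<noteq> 0" using a by (simp add: minimal_dependency_def)
  have ai: "a $ ?i \<noteq> 0" by (rule min_index_nonzero[OF a0])
  have sizeU: "int (size ?U) = (\<Sum>l\<in>UNIV. q l)" using q' by (intro size_signed_mset)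
  have sizeD: "int (size ?D) = (\<Sum>l\<in>UNIV. \<bar>a $ l\<bar>)"
    unfolding dep_mset_eq_signed_mset by (rule size_signed_mset) simp
  have half: "size ?D < 2 * size ?U \<or> size ?D = 2 * size ?U \<and> (a $ ?i > 0 \<longrightarrow> q ?i = 0) \<and>
      (a $ ?i < 0 \<longrightarrow> q ?i < \<bar>a $ ?i\<bar>)"
    using q sizeU sizeD unfolding favourable_def by linarith
  note countU = count_signed_mset[OF q']
  have mk1: ?thesis if "size ?D = 2 * k" "M \<subseteq># ?U" "size M = k" "a $ ?i > 0 \<longrightarrow> ?F \<notin># M"
    "a $ ?i < 0 \<longrightarrow> count M (- ?F) < nat \<bar>a $ ?i\<bar>" for k M
  proof -
    have "(mset_monomial M, mset_monomial (image_mset uminus (?D - M))) \<in> binomials1 A"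
      unfolding binomials1_def
      using that a UD
      by (auto simp flip: count_le_replicate_mset_subset_eq intro!: exI[of _ a] exI[of _ k] exI[of _ M])
    then show ?thesis using that(2) unfolding binomials_def by blast
  qed
  show ?thesis
  proof (cases "even (size ?D)")
    case False
    then obtain k where k: "size ?D = 2 * k + 1" by (elim oddE)
    \<comment> \<open>Odd size rules out exactly half, so \<open>half\<close> provides at least
      \<open>k + 1\<close> elements.\<close>
    then obtain M where M: "M \<subseteq># ?U" "size M = k + 1"
      using exists_submset_of_size[of "k + 1" ?U] half by auto
    then have "(mset_monomial M, Var 0 * mset_monomial (image_mset uminus (?D - M))) \<in> binomials2 A"
      unfolding binomials2_def using a k UD subset_mset.order_trans[OF M(1) UD] by blast
    then show ?thesis using M(1) unfolding binomials_def by blast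
  next
    case True
    then obtain k where k: "size ?D = 2 * k" by (elim evenE)
    show ?thesis
    proof (cases "size ?U = k")
      case True
      then have "a $ ?i > 0 \<longrightarrow> q ?i = 0" "a $ ?i < 0 \<longrightarrow> q ?i < \<bar>a $ ?i\<bar>"
        using half k by auto
      then show ?thesis
        using k True countU q'(1)[of ?i]
        by (intro mk1[of k ?U]) (auto simp flip: count_greater_zero_iff split: if_splits)
    next
      case False
      then have larger: "k + 1 \<le> size ?U" using half k by linarith
      show ?thesis
      proof (cases "a $ ?i > 0 \<and> count ?U ?F \<ge> 2")
        case True
        have "size ?U \<le> size ?D" by (rule size_mset_mono[OF UD])
        then have "k \<ge> 1" using larger k by linarith
        \<comment> \<open>Reserve two copies of \<open>?F\<close>, then top up with
          \<open>k - 1\<close> further elements.\<close>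
        have "replicate_mset 2 ?F \<subseteq># ?U"
          using True by (simp flip: count_le_replicate_mset_subset_eq)
        then obtain U' where U': "?U = replicate_mset 2 ?F + U'"
          by (metis subset_mset.le_iff_add)
        then have "k - 1 \<le> size U'" using larger by simp
        then obtain N where N: "N \<subseteq># U'" "size N = k - 1"
          using exists_submset_of_size by metis
        let ?M = "replicate_mset 2 ?F + N"
        have M: "?M \<subseteq># ?U" "size ?M = k + 1" "count ?M ?F \<ge> 2"
          using N U' \<open>k \<ge> 1\<close> by auto
        then have "(mset_monomial ?M, Var 0 ^ 2 * mset_monomial (image_mset uminus (?D - ?M))) \<in> binomials3 A"
          unfolding binomials3_def using a k subset_mset.order_trans[OF M(1) UD] by blast
        then show ?thesis using M(1) unfolding binomials_def by blast
      next
        case few: False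
        \<comment> \<open>Removing one copy of the least signed column leaves at least
          \<open>k\<close> elements. In the positive case at most one copy was present, so none
          survives; in the negative case fewer than the full multiplicity survive.\<close>
        let ?G = "sgn (a $ ?i) *s ?F"
        have "k \<le> size (?U - {#?G#})" using larger by (auto simp: size_Diff_singleton_if)
        then obtain M where M: "M \<subseteq># ?U - {#?G#}" "size M = k"
          using exists_submset_of_size by metis
        have MU: "M \<subseteq># ?U" using M(1) by (meson diff_subset_eq_self subset_mset.order_trans)
        have cM: "count M ?G \<le> count ?U ?G - 1" using mset_subset_eq_count[OF M(1), of ?G] by simp
        show ?thesis
        proof (rule mk1[OF k MU M(2)]; intro impI)
          assume "a $ ?i > 0"
          then show "?F \<notin># M" using cM few by (simp add: not_in_iff)
        next
          assume neg: "a $ ?i < 0"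
          then show "count M (- ?F) < nat \<bar>a $ ?i\<bar>" using cM q'(2)[of ?i]
            by (simp add: countU flip: vector_sneg_minus1)
        qed
      qed
    qed
  qed
qed

section \<open>From two monomials of equal toric degree to a dependency\<close>

lemma toric_degree_lattice:
  assumes "Poly_Mapping.keys \<mu> \<subseteq> V"
  shows "fst (toric_degree \<mu>) = (\<Sum>i\<in>UNIV. (int (Poly_Mapping.lookup \<mu> (column i A)) -
      int (Poly_Mapping.lookup \<mu> (- column i A))) *s column i A)"
    and "snd (toric_degree \<mu>) = (\<Sum>\<alpha>\<in>V. Poly_Mapping.lookup \<mu> \<alpha>)"
proof -
  have "int a *s x + int b *s (- x) = (int a - int b) *s x" for a b and x :: "int ^ 'm"
    by (simp add: vec_eq_iff algebra_simps)
  then show "fst (toric_degree \<mu>) = (\<Sum>i\<in>UNIV. (int (Poly_Mapping.lookup \<mu> (column i A)) -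
      int (Poly_Mapping.lookup \<mu> (- column i A))) *s column i A)"
    using assms by (simp add: toric_degree_superset[of V] sum_lattice_points)
  show "snd (toric_degree \<mu>) = (\<Sum>\<alpha>\<in>V. Poly_Mapping.lookup \<mu> \<alpha>)"
    using assms by (simp add: toric_degree_superset[of V])
qed

text \<open>The difference \<open>b\<close> of the net exponents \<open>d\<close> of \<mu> and
  \<open>e\<close> of \<nu> is a dependency because the toric degrees agree. The surplus of
  \<open>p\<close> is the sum of all \<open>\<bar>d i\<bar> - \<bar>e i\<bar>\<close>; it is
  nonnegative since \<mu>, free of opposite pairs, has the same degree as \<nu> and no more factors
  \<open>z\<close>. With no surplus, the first difference in the order yields (a) and (b).\<close>

lemma nonleading_difference:
  fixes \<mu> \<nu> :: "int ^ 'm \<Rightarrow>\<^sub>0 nat"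
  assumes \<mu>: "Poly_Mapping.keys \<mu> \<subseteq> V" and \<nu>: "Poly_Mapping.keys \<nu> \<subseteq> V"
    and deg: "toric_degree \<mu> = toric_degree \<nu>" and less: "degrevlex_less (variables A) \<nu> \<mu>"
    and free: "\<And>i. Poly_Mapping.lookup \<mu> (column i A) = 0 \<or> Poly_Mapping.lookup \<mu> (- column i A) = 0"
  shows "\<exists>b p. A *v b = 0 \<and> b \<noteq> 0 \<and> favourable b p \<and>
    (\<forall>i. b $ i > 0 \<longrightarrow> p i \<le> int (Poly_Mapping.lookup \<mu> (column i A))) \<and>
    (\<forall>i. b $ i < 0 \<longrightarrow> p i \<le> int (Poly_Mapping.lookup \<mu> (- column i A)))"
proof -
  let ?u = "\<lambda>x. int (Poly_Mapping.lookup \<mu> x)" and ?v = "\<lambda>x. int (Poly_Mapping.lookup \<nu> x)"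
  define d where "d i = ?u (column i A) - ?u (- column i A)" for i
  define e where "e i = ?v (column i A) - ?v (- column i A)" for i
  define b :: "int ^ 's::{finite, linorder}" where "b = (\<chi> i. d i - e i)"
  \<comment> \<open>Of each signed column in the multiset of \<open>b\<close>, take as many copies
    as \<mu> contains.\<close>
  define p where "p i = min \<bar>b $ i\<bar> (if b $ i > 0 then ?u (column i A) else ?u (- column i A))" for i
  have b [simp]: "b $ i = d i - e i" for i by (simp add: b_def)
  have ker: "A *v b = 0"
    using toric_degree_lattice(1)[OF \<mu>] toric_degree_lattice(1)[OF \<nu>] deg
    by (simp add: matrix_mult_sum vector_sub_rdistrib sum_subtractf flip: d_def e_def)
  have deg_sum: "(\<Sum>\<alpha>\<in>V. Poly_Mapping.lookup \<mu> \<alpha>) = (\<Sum>\<alpha>\<in>V. Poly_Mapping.lookup \<nu> \<alpha>)"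
    using toric_degree_lattice(2)[OF \<mu>] toric_degree_lattice(2)[OF \<nu>] deg by simp
  have not_less: "\<not> degrevlex_less (variables A) \<mu> \<nu>"
    using less degrevlex_trans degrevlex_irrefl by blast
  have origin: "?u 0 \<le> ?v 0"
    using not_less degrevlex_origin[OF deg_sum] by (auto intro: leI)
  have \<mu>_free: "?u (column i A) = max (d i) 0" "?u (- column i A) = max (- d i) 0" for i
    using free[of i] by (auto simp: d_def)
  have abs_d: "\<bar>d i\<bar> = ?u (column i A) + ?u (- column i A)" for i
    by (auto simp: \<mu>_free)
  have abs_e: "\<bar>e i\<bar> \<le> ?v (column i A) + ?v (- column i A)" for i
    by (auto simp: e_def)
  \<comment> \<open>A case check on the signs of \<open>d i\<close>, \<open>e i\<close> and
    \<open>b $ i\<close>; it turns the surplus over one half into a comparison of degrees.\<close>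
  have "2 * p i - \<bar>b $ i\<bar> = \<bar>d i\<bar> - \<bar>e i\<bar>" for i
    unfolding p_def \<mu>_free by (auto simp: min_def max_def abs_if)
  then have excess: "2 * (\<Sum>i\<in>UNIV. p i) - (\<Sum>i\<in>UNIV. \<bar>b $ i\<bar>) = (\<Sum>i\<in>UNIV. \<bar>d i\<bar>) - (\<Sum>i\<in>UNIV. \<bar>e i\<bar>)"
    by (simp add: sum_distrib_left flip: sum_subtractf)
  have "(\<Sum>\<alpha>\<in>V. ?u \<alpha>) = (\<Sum>\<alpha>\<in>V. ?v \<alpha>)"
    using deg_sum by (simp flip: of_nat_sum)
  then have balance: "?u 0 + (\<Sum>i\<in>UNIV. \<bar>d i\<bar>) =
      ?v 0 + (\<Sum>i\<in>UNIV. ?v (column i A) + ?v (- column i A))"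
    by (simp add: sum_lattice_points abs_d)
  have sum_e: "(\<Sum>i\<in>UNIV. \<bar>e i\<bar>) \<le> (\<Sum>i\<in>UNIV. ?v (column i A) + ?v (- column i A))"
    by (intro sum_mono abs_e)
  have p: "0 \<le> p i" "p i \<le> \<bar>b $ i\<bar>" for i by (auto simp: p_def)
  \<comment> \<open>Exactly half leaves no slack: the exponents of the origin agree, and \<nu>, like
    \<mu>, contains no opposite pair.\<close>
  have eq: "?u 0 = ?v 0 \<and> (\<forall>i. ?v (column i A) = max (e i) 0 \<and> ?v (- column i A) = max (- e i) 0)"
    if "(\<Sum>i\<in>UNIV. \<bar>b $ i\<bar>) = 2 * (\<Sum>i\<in>UNIV. p i)"
  proof -
    have "?u 0 = ?v 0" and sum_eq: "(\<Sum>i\<in>UNIV. \<bar>e i\<bar>) = (\<Sum>i\<in>UNIV. ?v (column i A) + ?v (- column i A))"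
      using that excess balance sum_e origin by linarith+
    have "(\<Sum>i\<in>UNIV. ?v (column i A) + ?v (- column i A) - \<bar>e i\<bar>) = 0"
      using sum_eq by (simp add: sum_subtractf)
    then have "\<forall>i. ?v (column i A) + ?v (- column i A) - \<bar>e i\<bar> = 0"
      using abs_e by (subst (asm) sum_nonneg_eq_0_iff) auto
    then have "?v (column i A) = max (e i) 0" "?v (- column i A) = max (- e i) 0" for i
      unfolding e_def by (drule_tac spec[of _ i], linarith)+
    with \<open>?u 0 = ?v 0\<close> show ?thesis by blast
  qed
  have b0: "b \<noteq> 0"
  proof
    \<comment> \<open>Here the case of exactly half applies trivially, and equal net exponents would
      make the two monomials coincide.\<close>
    assume "b = 0"
    then have de: "d i = e i" for i using b[of i] by simp
    have "p i = 0" for i using p[of i] \<open>b = 0\<close> by simp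
    then have *: "?u 0 = ?v 0" "?v (column i A) = max (e i) 0" "?v (- column i A) = max (- e i) 0" for i
      using eq \<open>b = 0\<close> by auto
    have "Poly_Mapping.lookup \<mu> x = Poly_Mapping.lookup \<nu> x" for x
    proof (cases "x \<in> V")
      case True
      have "?u (column i A) = ?v (column i A)" "?u (- column i A) = ?v (- column i A)" for i
        by (simp_all only: \<mu>_free * de)
      with *(1) show ?thesis using True by (auto simp: lattice_points_eq)
    next
      case False
      then show ?thesis using \<mu> \<nu> by (metis in_keys_iff subsetD)
    qed
    then have "\<mu> = \<nu>" by (rule poly_mapping_eqI)
    then show False using less by (simp add: degrevlex_irrefl)
  qed
  have "favourable b p"
  proof (cases "(\<Sum>i\<in>UNIV. \<bar>b $ i\<bar>) = 2 * (\<Sum>i\<in>UNIV. p i)")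
    case False
    then show ?thesis using excess balance sum_e origin p unfolding favourable_def by simp
  next
    case True
    let ?i = "min_index b"
    note \<nu>_free = eq[OF True]
    \<comment> \<open>Below the least index of \<open>b\<close> the exponents agree, so a larger
      exponent of \<mu> here would make \<mu> the smaller monomial.\<close>
    have not_greater: "\<not> (?u (column ?i A) > ?v (column ?i A) \<or>
        ?u (column ?i A) = ?v (column ?i A) \<and> ?u (- column ?i A) > ?v (- column ?i A))"
    proof
      assume "?u (column ?i A) > ?v (column ?i A) \<or>
        ?u (column ?i A) = ?v (column ?i A) \<and> ?u (- column ?i A) > ?v (- column ?i A)"
      then have *: "Poly_Mapping.lookup \<nu> (column ?i A) < Poly_Mapping.lookup \<mu> (column ?i A) \<or>
        Poly_Mapping.lookup \<mu> (column ?i A) = Poly_Mapping.lookup \<nu> (column ?i A) \<and>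
        Poly_Mapping.lookup \<nu> (- column ?i A) < Poly_Mapping.lookup \<mu> (- column ?i A)" by simp
      have "d j = e j" if "j < ?i" for j using zero_below_min_index[OF that] by simp
      then have "?u (column j A) = ?v (column j A)" "?u (- column j A) = ?v (- column j A)" if "j < ?i" for j
        using \<nu>_free \<mu>_free[of j] that by simp_all
      then have "Poly_Mapping.lookup \<mu> (column j A) = Poly_Mapping.lookup \<nu> (column j A)"
        "Poly_Mapping.lookup \<mu> (- column j A) = Poly_Mapping.lookup \<nu> (- column j A)" if "j < ?i" for j
        using that of_nat_eq_iff by blast+
      then have "degrevlex_less (variables A) \<mu> \<nu>"
        using degrevlex_column[OF deg_sum _ _ _ *] \<nu>_free by simp
      then show False using not_less by simp
    qed
    \<comment> \<open>If \<open>d > e\<close> at this index, no larger exponent of \<open>F\<close>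
      in \<mu> means \<open>d \<le> 0\<close>, so \<mu> does not contain \<open>F\<close>.\<close>
    have cond_pos: "b $ ?i > 0 \<longrightarrow> p ?i = 0"
      using not_greater \<nu>_free unfolding p_def \<mu>_free by auto
    \<comment> \<open>If \<open>d < e\<close>, a tie at \<open>F\<close> would make both nonpositive
      and give \<mu> more copies of \<open>-F\<close>. Hence \<open>e > 0\<close>, and \<mu>
      contains \<open>-F\<close> fewer than \<open>e - d\<close> times.\<close>
    have cond_neg: "b $ ?i < 0 \<longrightarrow> p ?i < \<bar>b $ ?i\<bar>"
      using not_greater \<nu>_free unfolding p_def \<mu>_free by auto
    show ?thesis unfolding favourable_def by (intro conjI allI disjI2 p True cond_pos cond_neg)
  qed
  moreover have "\<forall>i. b $ i > 0 \<longrightarrow> p i \<le> ?u (column i A)" "\<forall>i. b $ i < 0 \<longrightarrow> p i \<le> ?u (- column i A)"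
    by (auto simp: p_def)
  ultimately show ?thesis using ker b0 by blast
qed

text \<open>An opposite pair in \<mu> is caught by type (4). Otherwise a minimal favourable
  dependency with the signs of \<open>b\<close> exists, and its chosen submultiset stays inside the
  part taken from \<mu>.\<close>

lemma binomial_below:
  fixes \<mu> \<nu> :: "int ^ 'm \<Rightarrow>\<^sub>0 nat"
  assumes \<mu>\<nu>: "Poly_Mapping.keys \<mu> \<subseteq> V" "Poly_Mapping.keys \<nu> \<subseteq> V"
    "toric_degree \<mu> = toric_degree \<nu>" "degrevlex_less (variables A) \<nu> \<mu>"
  shows "\<exists>M y. (mset_monomial M, y) \<in>
      (binomials A :: ((int ^ 'm, 'k::comm_ring_1) mpoly \<times> (int ^ 'm, 'k) mpoly) set) \<and>
      (\<forall>x. count M x \<le> Poly_Mapping.lookup \<mu> x)"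
proof (cases "\<forall>i. Poly_Mapping.lookup \<mu> (column i A) = 0 \<or> Poly_Mapping.lookup \<mu> (- column i A) = 0")
  case False
  then obtain i where i: "Poly_Mapping.lookup \<mu> (column i A) > 0" "Poly_Mapping.lookup \<mu> (- column i A) > 0"
    by auto
  let ?M = "{#column i A, - column i A#}"
  have "(mset_monomial ?M, Var 0 ^ 2) \<in> binomials4 A"
    by (auto simp: binomials4_def mset_monomial_def)
  moreover have "\<forall>x. count ?M x \<le> Poly_Mapping.lookup \<mu> x"
    using i column_eq_iff(2)[of i i] by (auto simp del: column_eq_iff)
  ultimately show ?thesis unfolding binomials_def by blast
next
  case True
  with nonleading_difference[OF \<mu>\<nu>] obtain b p where b: "A *v b = 0" "b \<noteq> 0" "favourable b p"
    and p: "\<And>i. b $ i > 0 \<Longrightarrow> p i \<le> int (Poly_Mapping.lookup \<mu> (column i A))"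
      "\<And>i. b $ i < 0 \<Longrightarrow> p i \<le> int (Poly_Mapping.lookup \<mu> (- column i A))"
    by blast
  from minimal_favourable[OF b] obtain a q where a: "minimal_dependency A a" "favourable a q"
    and sgn: "\<And>i. a $ i \<noteq> 0 \<Longrightarrow> sgn (a $ i) = sgn (b $ i)" and qp: "\<And>i. q i \<le> p i" by blast
  from minimal_favourable_binomial[OF a] obtain M y where
    M: "(mset_monomial M, y) \<in> (binomials A :: ((int ^ 'm, 'k) mpoly \<times> (int ^ 'm, 'k) mpoly) set)"
      "M \<subseteq># signed_mset A a q" by blast
  have q: "0 \<le> q l" "q l \<le> \<bar>a $ l\<bar>" for l using a(2) by (auto simp: favourable_def)
  have "count M x \<le> Poly_Mapping.lookup \<mu> x" for x
  proof -
    have cM: "count M x \<le> count (signed_mset A a q) x" by (rule mset_subset_eq_count[OF M(2)])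
    have pos: "nat (q i) \<le> Poly_Mapping.lookup \<mu> (column i A)" if "a $ i > 0" for i
    proof -
      have "b $ i > 0" using sgn[of i] that by (metis less_irrefl sgn_greater)
      from p(1)[OF this] qp[of i] show ?thesis by linarith
    qed
    have neg: "nat (q i) \<le> Poly_Mapping.lookup \<mu> (- column i A)" if "a $ i < 0" for i
    proof -
      have "b $ i < 0" using sgn[of i] that by (metis less_irrefl sgn_less)
      from p(2)[OF this] qp[of i] show ?thesis by linarith
    qed
    have "set_mset (signed_mset A a q) \<subseteq> V"
      using set_mset_mono[OF signed_mset_subset_dep[OF q(2)]] set_dep_mset by blast
    then consider "count (signed_mset A a q) x = 0" | i where "x = column i A" | i where "x = - column i A"
      using signed_column_cases[of x] count_signed_mset(3)[OF q] by (metis not_in_iff subsetD)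
    then show ?thesis
    proof cases
      case (2 i)
      then show ?thesis using cM pos[of i] by (auto simp: count_signed_mset[OF q] split: if_splits)
    next
      case (3 i)
      then show ?thesis using cM neg[of i] by (auto simp: count_signed_mset[OF q] split: if_splits)
    qed (use cM in simp)
  qed
  then show ?thesis using M(1) by blast
qed

end

theorem theorem4p1:
  fixes A :: "int ^ 's::{finite, linorder} ^ 'm::finite"
  assumes saturated: "saturated A"
    and nonzero_columns: "\<And>i. column i A \<noteq> 0"
  shows "groebner_basis (lattice_points (polytope_of A)) (degrevlex_less (variables A))
           (toric_ideal (polytope_of A) :: (int ^ 'm, 'k::field) mpoly set)
           {u - v | u v. (u, v) \<in> binomials A}
       \<and> (\<forall>(u, v) \<in> (binomials A :: ((int ^ 'm, 'k) mpoly \<times> (int ^ 'm, 'k) mpoly) set).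
            is_initial_term (degrevlex_less (variables A)) (u - v) u)"
proof
  interpret saturated_matrix A using assms by unfold_locales
  let ?Bin = "binomials A :: ((int ^ 'm, 'k) mpoly \<times> (int ^ 'm, 'k) mpoly) set"
  \<comment> \<open>Passing to exponent vectors loses nothing: every listed monomial has coefficient
    one, and \<open>1 \<noteq> 0\<close> makes its exponent unique.\<close>
  define B where "B = {(\<mu>, \<nu>). (Poly_Mapping.single \<mu> 1, Poly_Mapping.single \<nu> 1) \<in> ?Bin}"
  have B: "Poly_Mapping.keys \<mu> \<subseteq> V \<and> Poly_Mapping.keys \<nu> \<subseteq> V \<and> toric_degree \<mu> = toric_degree \<nu> \<and>
      degrevlex_less (variables A) \<nu> \<mu>" if "(\<mu>, \<nu>) \<in> B" for \<mu> \<nu>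
  proof -
    have "(Poly_Mapping.single \<mu> 1, Poly_Mapping.single \<nu> 1) \<in> ?Bin" using that by (simp add: B_def)
    from binomials_homogeneous[OF this] show ?thesis
      by (metis keys_single singleton_inject zero_neq_one)
  qed
  have binomials_B: "\<exists>\<mu> \<nu>. u = Poly_Mapping.single \<mu> 1 \<and> v = Poly_Mapping.single \<nu> 1 \<and> (\<mu>, \<nu>) \<in> B"
    if "(u, v) \<in> ?Bin" for u v
    using binomials_homogeneous[OF that] that by (auto simp: B_def)
  have lead: "\<exists>\<alpha> \<beta> \<rho>. (\<alpha>, \<beta>) \<in> B \<and> \<mu> = \<rho> + \<alpha>"
    if "Poly_Mapping.keys \<mu> \<subseteq> V" "Poly_Mapping.keys \<nu> \<subseteq> V" "toric_degree \<mu> = toric_degree \<nu>"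
      "degrevlex_less (variables A) \<nu> \<mu>" for \<mu> \<nu>
  proof -
    from binomial_below[OF that] obtain M y where M: "(mset_monomial M, y) \<in> ?Bin"
      "\<forall>x. count M x \<le> Poly_Mapping.lookup \<mu> x" by blast
    from binomials_B[OF M(1)] obtain \<alpha> \<beta> where *: "mset_monomial M = Poly_Mapping.single \<alpha> (1 :: 'k)"
      "(\<alpha>, \<beta>) \<in> B" by blast
    have "\<alpha> = exponent M"
      using *(1) by (metis mset_monomial_eq_single keys_single singleton_inject zero_neq_one)
    \<comment> \<open>Divisibility makes the truncated subtraction exact in every variable.\<close>
    then have "\<mu> = (\<mu> - \<alpha>) + \<alpha>"
      using M(2) by (intro poly_mapping_eqI) (simp add: lookup_add lookup_minus)
    then show ?thesis using *(2) by blast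
  qed
  have "groebner_basis V (degrevlex_less (variables A))
      {p \<in> carrier (mpoly_ring V :: (int ^ 'm, 'k) mpoly ring). pushforward toric_degree p = 0}
      {Poly_Mapping.single \<mu> 1 - Poly_Mapping.single \<nu> 1 | \<mu> \<nu>. (\<mu>, \<nu>) \<in> B}"
  proof (rule groebner_basis_binomials[OF distinct_variables set_variables toric_degree_add _ B lead])
    fix \<mu> \<nu> :: "int ^ 'm \<Rightarrow>\<^sub>0 nat"
    assume "Poly_Mapping.keys \<mu> \<subseteq> V" "Poly_Mapping.keys \<nu> \<subseteq> V" "toric_degree \<mu> = toric_degree \<nu>"
    then show "(\<Sum>x\<in>V. Poly_Mapping.lookup \<mu> x) = (\<Sum>x\<in>V. Poly_Mapping.lookup \<nu> x)"
      using toric_degree_lattice(2) by metis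
  qed
  moreover have "{Poly_Mapping.single \<mu> 1 - Poly_Mapping.single \<nu> 1 | \<mu> \<nu>. (\<mu>, \<nu>) \<in> B} =
      {u - v | u v. (u, v) \<in> ?Bin}"
  proof (intro equalityI subsetI)
    fix x assume "x \<in> {Poly_Mapping.single \<mu> 1 - Poly_Mapping.single \<nu> (1 :: 'k) | \<mu> \<nu>. (\<mu>, \<nu>) \<in> B}"
    then show "x \<in> {u - v | u v. (u, v) \<in> ?Bin}" by (auto simp: B_def)
  next
    fix x assume "x \<in> {u - v | u v. (u, v) \<in> ?Bin}"
    then show "x \<in> {Poly_Mapping.single \<mu> 1 - Poly_Mapping.single \<nu> (1 :: 'k) | \<mu> \<nu>. (\<mu>, \<nu>) \<in> B}"
      using binomials_B by fastforce
  qed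
  ultimately show "groebner_basis V (degrevlex_less (variables A))
      (toric_ideal (polytope_of A) :: (int ^ 'm, 'k) mpoly set) {u - v | u v. (u, v) \<in> ?Bin}"
    by (simp add: toric_ideal_def toric_map_eq_pushforward)
  show "\<forall>(u, v) \<in> ?Bin. is_initial_term (degrevlex_less (variables A)) (u - v) u"
  proof clarify
    fix u v assume "(u, v) \<in> ?Bin"
    from binomials_B[OF this] obtain \<mu> \<nu> where *: "u = Poly_Mapping.single \<mu> 1"
      "v = Poly_Mapping.single \<nu> 1" "(\<mu>, \<nu>) \<in> B" by blast
    have "degrevlex_less (variables A) \<nu> \<mu>" using B[OF *(3)] by blast
    moreover from this have "\<nu> \<noteq> \<mu>" using degrevlex_irrefl by blast
    ultimately show "is_initial_term (degrevlex_less (variables A)) (u - v) u"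
      unfolding *(1,2) by (rule is_initial_term_binomial)
  qed
qed

end
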